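(* Let $G$ be a $\sigma$-compact locally compact Abelian group with Haar measure $\lambda_G$, and let $\Omega\subset G$ be a closed neighbourhood of $0$ with $\lambda_G(\Omega)<\infty$. Then there exists $f\in\mathcal{G}_G(\Omega)$ with $\int_G f\,d\lambda_G=\mathcal{D}_G(\Omega)$ (an extremal function for $\mathcal{D}_G(\Omega)$). Moreover, there is a sequence $(f_n)_{n\in\mathbb{N}}$ in $\mathcal{G}_G(\Omega)$ with $\int_G f_n\,d\lambda_G\to\mathcal{D}_G(\Omega)$ that converges to $f$ uniformly on the compact subsets of $G$.
   Context: All locally compact Abelian groups are Hausdorff, with identity $0$. A function $f:G\to\mathbb{C}$ is positive definite if $\sum_{i,j=1}^n c_i\overline{c_j} f(g_i-g_j)\ge 0$ for all $n\in\mathbb{N}$, $c_i\in\mathbb{C}$, $g_i\in G$. $P_1(G)$ denotes the set of continuous positive definite functions $f:G\to\mathbb{R}$ with $f(0)=1$. For $f:G\to\mathbb{R}$, $f_+(g):=\max\{f(g),0\}$ and $\operatorname{supp} f:=\overline{\{g: f(g)\neq 0\}}$. Define $\mathcal{G}_G(\Omega):=\{f\in P_1(G)\cap L^1(G): \operatorname{supp} f_+\subset\Omega\}$ and $\mathcal{D}_G(\Omega):=\sup_{f\in\mathcal{G}_G(\Omega)}\int_G f\,d\lambda_G$. *)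

theory Defs
  imports "HOL-Analysis.Analysis"
begin

text \<open>G is modelled as a type 'a of class topological_ab_group_add + t2_space
  (Hausdorff Abelian topological group), with the extra hypotheses of local
  compactness and sigma-compactness stated separately.\<close>

definition sigma_compact_type :: "'a::topological_space itself \<Rightarrow> bool" where
  "sigma_compact_type _ \<longleftrightarrow>
     (\<exists>K :: nat \<Rightarrow> 'a set. (\<forall>n. compact (K n)) \<and> (\<Union>n. K n) = UNIV)"

definition haar_measure :: "'a::topological_ab_group_add measure \<Rightarrow> bool" where
  "haar_measure M \<longleftrightarrow>
     sets M = sets borel \<and>
     (\<forall>A\<in>sets M. \<forall>x. emeasure M ((\<lambda>y. x + y) ` A) = emeasure M A) \<and>
     (\<forall>K. compact K \<longrightarrow> emeasure M K < \<infinity>) \<and>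
     (\<forall>U. open U \<and> U \<noteq> {} \<longrightarrow> emeasure M U > 0) \<and>
     (\<forall>A\<in>sets M. emeasure M A = (INF U\<in>{U. open U \<and> A \<subseteq> U}. emeasure M U)) \<and>
     (\<forall>U. open U \<longrightarrow> emeasure M U = (SUP K\<in>{K. compact K \<and> K \<subseteq> U}. emeasure M K))"

definition positive_definite :: "('a::ab_group_add \<Rightarrow> complex) \<Rightarrow> bool" where
  "positive_definite f \<longleftrightarrow>
     (\<forall>(n::nat) (c::nat \<Rightarrow> complex) (g::nat \<Rightarrow> 'a).
        let s = (\<Sum>i<n. \<Sum>j<n. c i * cnj (c j) * f (g i - g j)) in Im s = 0 \<and> Re s \<ge> 0)"

definition P1 :: "('a::topological_ab_group_add \<Rightarrow> real) set" where
  "P1 = {f. continuous_on UNIV f \<and> positive_definite (\<lambda>x. complex_of_real (f x)) \<and> f 0 = 1}"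

definition pos_part :: "('a \<Rightarrow> real) \<Rightarrow> 'a \<Rightarrow> real" where
  "pos_part f = (\<lambda>g. max (f g) 0)"

definition supp :: "('a::topological_space \<Rightarrow> real) \<Rightarrow> 'a set" where
  "supp f = closure {g. f g \<noteq> 0}"

definition turan_class :: "'a::topological_ab_group_add measure \<Rightarrow> 'a set \<Rightarrow> ('a \<Rightarrow> real) set" where
  "turan_class M \<Omega> = {f \<in> P1. integrable M f \<and> supp (pos_part f) \<subseteq> \<Omega>}"

text \<open>\<D>_G(\<Omega>) as an extended real supremum (to avoid junk values of real Sup).\<close>
definition turan_const :: "'a::topological_ab_group_add measure \<Rightarrow> 'a set \<Rightarrow> ereal" where
  "turan_const M \<Omega> = (SUP f\<in>turan_class M \<Omega>. ereal (integral\<^sup>L M f))"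

end

theory Submission
  imports Defs
begin

text \<open>Take a maximizing sequence. By convexity of the class, choosing functions of nearly minimal
  \<open>L\<^sup>2\<close> norm makes it \<open>L\<^sup>2\<close>-Cauchy, so it may be assumed to converge almost everywhere to some
  \<open>F\<close>; since the functions lie below the indicator of \<open>\<Omega>\<close>, Fatou's lemma shows that \<open>F\<close> is
  integrable and that its integral is at least the supremum. By Tychonoff's theorem the sequence
  has a pointwise cluster point, a possibly discontinuous positive definite \<open>p\<close> with \<open>p 0 = 1\<close> which
  agrees with \<open>F\<close> almost everywhere. Its continuous part \<open>g\<close> still agrees with \<open>F\<close> almost
  everywhere and satisfies \<open>g 0 \<le> 1\<close>, so \<open>g / g 0\<close> lies in the class and is extremal; here
  \<open>g 0 \<noteq> 0\<close> because the supremum is positive. As \<open>f\<close> itself belongs to the class, the constant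
  sequence serves as the approximating sequence.\<close>

section \<open>Real-valued positive definite functions\<close>

text \<open>Symmetry is demanded separately: with real coefficients the quadratic form only sees the
  even part of \<open>f\<close>, whereas complex coefficients force a real-valued \<open>f\<close>
  to be even.\<close>

definition real_positive_definite :: "('a::ab_group_add \<Rightarrow> real) \<Rightarrow> bool" where
  "real_positive_definite f \<longleftrightarrow> (\<forall>x. f (- x) = f x) \<and>
     (\<forall>(n::nat) c g. 0 \<le> (\<Sum>i<n. \<Sum>j<n. c i * c j * f (g i - g j)))"

lemma real_positive_definite_minus: "real_positive_definite f \<Longrightarrow> f (- x) = f x"
  by (simp add: real_positive_definite_def)

lemma real_positive_definite_sum_ge_0:
  assumes "real_positive_definite f"
  shows "0 \<le> (\<Sum>i<(n::nat). \<Sum>j<n. c i * c j * f (g i - g j))"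
  using assms by (simp add: real_positive_definite_def)

text \<open>Averaging over translates leads to forms indexed by pairs, hence the passage to
  arbitrary finite index sets.\<close>

lemma real_positive_definite_finite_sum_ge_0:
  assumes f: "real_positive_definite f" and "finite I"
  shows "0 \<le> (\<Sum>i\<in>I. \<Sum>j\<in>I. c i * c j * f (g i - g j))"
proof -
  obtain h where h: "bij_betw h {..<card I} I"
    using ex_bij_betw_nat_finite[OF \<open>finite I\<close>] by (auto simp: atLeast0LessThan)
  have "0 \<le> (\<Sum>i<card I. \<Sum>j<card I. c (h i) * c (h j) * f (g (h i) - g (h j)))"
    using real_positive_definite_sum_ge_0[OF f, of "\<lambda>i. c (h i)" "\<lambda>i. g (h i)"] .
  also have "\<dots> = (\<Sum>i<card I. \<Sum>j\<in>I. c (h i) * c j * f (g (h i) - g j))"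
    by (intro sum.cong refl sum.reindex_bij_betw[OF h])
  also have "\<dots> = (\<Sum>i\<in>I. \<Sum>j\<in>I. c i * c j * f (g i - g j))"
    by (rule sum.reindex_bij_betw[OF h])
  finally show ?thesis .
qed

text \<open>For symmetric \<open>f\<close> the Hermitian form at \<open>c\<close> is the sum of the
  real forms at \<open>Re c\<close> and \<open>Im c\<close>; the cross terms are purely imaginary
  and cancel in pairs.\<close>

lemma positive_definite_of_real_iff:
  "positive_definite (\<lambda>x. complex_of_real (f x)) \<longleftrightarrow> real_positive_definite f"
proof
  assume pd: "positive_definite (\<lambda>x. complex_of_real (f x))"
  \<comment> \<open>Coefficients 1 and \<open>\<i>\<close> at the points \<open>x\<close> and 0 give
    a form with imaginary part \<open>f (- x) - f x\<close>.\<close>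
  have "f (- x) = f x" for x
    using pd[unfolded positive_definite_def Let_def, rule_format, of
        "\<lambda>i. if i = 0 then 1 else \<i>" "\<lambda>i. if i = 0 then x else 0" 2]
    by (simp add: numeral_2_eq_2)
  moreover have "0 \<le> (\<Sum>i<n. \<Sum>j<n. c i * c j * f (g i - g j))" for n :: nat and c g
    using pd[unfolded positive_definite_def Let_def, rule_format, of "\<lambda>i. of_real (c i)" g n]
    by simp
  ultimately show "real_positive_definite f"
    by (simp add: real_positive_definite_def)
next
  assume f: "real_positive_definite f"
  show "positive_definite (\<lambda>x. complex_of_real (f x))"
    unfolding positive_definite_def Let_def
  proof (intro allI conjI)
    fix n :: nat and c :: "nat \<Rightarrow> complex" and g :: "nat \<Rightarrow> 'a"
    have sym: "f (g i - g j) = f (g j - g i)" for i j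
      using real_positive_definite_minus[OF f, of "g j - g i"] by simp
    let ?t = "\<lambda>i j. Im (c i) * Re (c j) * f (g i - g j)"
    have "Im (\<Sum>i<n. \<Sum>j<n. c i * cnj (c j) * of_real (f (g i - g j)))
        = (\<Sum>i<n. \<Sum>j<n. ?t i j) - (\<Sum>i<n. \<Sum>j<n. ?t j i)"
      using sym by (simp add: sum_subtractf[symmetric] algebra_simps)
    also have "(\<Sum>i<n. \<Sum>j<n. ?t j i) = (\<Sum>i<n. \<Sum>j<n. ?t i j)"
      by (rule sum.swap)
    finally show "Im (\<Sum>i<n. \<Sum>j<n. c i * cnj (c j) * of_real (f (g i - g j))) = 0"
      by simp
    have "Re (\<Sum>i<n. \<Sum>j<n. c i * cnj (c j) * of_real (f (g i - g j)))
        = (\<Sum>i<n. \<Sum>j<n. Re (c i) * Re (c j) * f (g i - g j))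
        + (\<Sum>i<n. \<Sum>j<n. Im (c i) * Im (c j) * f (g i - g j))"
      by (simp add: sum.distrib[symmetric] algebra_simps)
    also have "\<dots> \<ge> 0"
      by (intro add_nonneg_nonneg real_positive_definite_sum_ge_0[OF f])
    finally show "0 \<le> Re (\<Sum>i<n. \<Sum>j<n. c i * cnj (c j) * of_real (f (g i - g j)))" .
  qed
qed

text \<open>Evaluate the form at the points \<open>x\<close> and 0 with coefficients 1 and
  \<open>s\<close>, for both signs of \<open>s\<close>.\<close>

lemma real_positive_definite_abs_le:
  assumes f: "real_positive_definite f"
  shows "\<bar>f x\<bar> \<le> f 0"
proof -
  have "0 \<le> 2 * f 0 + 2 * s * f x" if "s = 1 \<or> s = -1" for s :: real
    using real_positive_definite_sum_ge_0[OF f, of "\<lambda>i. if i = 0 then 1 else s"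
        "\<lambda>i. if i = 0 then x else 0" 2] real_positive_definite_minus[OF f, of x] that
    by (auto simp: numeral_2_eq_2)
  from this[of 1] this[of "-1"] show ?thesis by simp
qed

text \<open>Krein's inequality, obtained from the form at \<open>x\<close>, \<open>y\<close>, 0. It
  reduces uniform continuity to a bound on the drop of \<open>f\<close> near 0.\<close>

lemma real_positive_definite_diff_square_le:
  assumes f: "real_positive_definite f"
  shows "(f x - f y)\<^sup>2 \<le> 2 * f 0 * (f 0 - f (x - y))"
proof -
  define d where "d = f x - f y"
  have sym: "f (y - x) = f (x - y)" "f (- x) = f x" "f (- y) = f y"
    using real_positive_definite_minus[OF f, of "x - y"]
      real_positive_definite_minus[OF f, of x] real_positive_definite_minus[OF f, of y] by simp_all
  \<comment> \<open>With coefficients 1, -1, t the form is quadratic in t and, for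
    \<open>f 0 > 0\<close>, minimal at \<open>- d / f 0\<close>; scaling all coefficients by
    \<open>f 0\<close> clears the denominator.\<close>
  have "0 \<le> (\<Sum>i<(3::nat). \<Sum>j<(3::nat). ((\<lambda>i. if i = 0 then f 0 else if i = 1 then - f 0 else - d) i)
      * ((\<lambda>i. if i = 0 then f 0 else if i = 1 then - f 0 else - d) j)
      * f ((\<lambda>i. if i = 0 then x else if i = 1 then y else 0) i
          - (\<lambda>i. if i = 0 then x else if i = 1 then y else 0) j))"
    by (rule real_positive_definite_sum_ge_0[OF f])
  also have "\<dots> = f 0 * (2 * f 0 * (f 0 - f (x - y)) - d\<^sup>2)"
    by (simp add: numeral_3_eq_3 sym d_def power2_eq_square algebra_simps)
  finally have *: "0 \<le> f 0 * (2 * f 0 * (f 0 - f (x - y)) - d\<^sup>2)" .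
  have "0 \<le> f 0"
    using real_positive_definite_abs_le[OF f, of 0] by simp
  show ?thesis
  proof (cases "f 0 = 0")
    case True
    with real_positive_definite_abs_le[OF f, of x] real_positive_definite_abs_le[OF f, of y]
    show ?thesis by simp
  next
    case False
    with \<open>0 \<le> f 0\<close> * show ?thesis by (simp add: zero_le_mult_iff d_def)
  qed
qed

lemma real_positive_definite_midpoint:
  assumes f: "real_positive_definite f" and g: "real_positive_definite g"
  shows "real_positive_definite (\<lambda>x. (f x + g x) / 2)"
  unfolding real_positive_definite_def
proof (intro conjI allI)
  show "(f (- x) + g (- x)) / 2 = (f x + g x) / 2" for x
    using real_positive_definite_minus[OF f] real_positive_definite_minus[OF g] by simp
  fix n :: nat and c h
  have "(\<Sum>i<n. \<Sum>j<n. c i * c j * ((f (h i - h j) + g (h i - h j)) / 2))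
      = ((\<Sum>i<n. \<Sum>j<n. c i * c j * f (h i - h j)) + (\<Sum>i<n. \<Sum>j<n. c i * c j * g (h i - h j))) / 2"
    by (simp add: sum.distrib[symmetric] sum_divide_distrib algebra_simps add_divide_distrib)
  also have "\<dots> \<ge> 0"
    using real_positive_definite_sum_ge_0[OF f, of c h n] real_positive_definite_sum_ge_0[OF g, of c h n]
    by simp
  finally show "0 \<le> (\<Sum>i<n. \<Sum>j<n. c i * c j * ((f (h i - h j) + g (h i - h j)) / 2))" .
qed

lemma real_positive_definite_divide:
  assumes f: "real_positive_definite f" and "0 < a"
  shows "real_positive_definite (\<lambda>x. f x / a)"
  unfolding real_positive_definite_def
proof (intro conjI allI)
  show "f (- x) / a = f x / a" for x
    using real_positive_definite_minus[OF f] by simp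
  fix n :: nat and c h
  have "(\<Sum>i<n. \<Sum>j<n. c i * c j * (f (h i - h j) / a))
      = (\<Sum>i<n. \<Sum>j<n. c i * c j * f (h i - h j)) / a"
    by (simp add: sum_divide_distrib)
  then show "0 \<le> (\<Sum>i<n. \<Sum>j<n. c i * c j * (f (h i - h j) / a))"
    using real_positive_definite_sum_ge_0[OF f, of c h n] \<open>0 < a\<close> by simp
qed

text \<open>Each condition involves finitely many values, so pointwise convergence suffices. A
  general filter is allowed because the cluster points used below need not be limits of
  subsequences.\<close>

lemma real_positive_definite_tendsto:
  assumes "L \<noteq> bot" and h: "\<And>n. real_positive_definite (h n)"
    and lim: "\<And>x. ((\<lambda>n. h n x) \<longlongrightarrow> f x) L"
  shows "real_positive_definite f"
  unfolding real_positive_definite_def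
proof (intro conjI allI)
  fix x
  have "((\<lambda>n. h n x) \<longlongrightarrow> f (- x)) L"
    using lim[of "- x"] real_positive_definite_minus[OF h] by simp
  then show "f (- x) = f x"
    using lim[of x] tendsto_unique[OF \<open>L \<noteq> bot\<close>] by blast
next
  fix n :: nat and c g
  have "((\<lambda>k. \<Sum>i<n. \<Sum>j<n. c i * c j * h k (g i - g j))
      \<longlongrightarrow> (\<Sum>i<n. \<Sum>j<n. c i * c j * f (g i - g j))) L"
    by (intro tendsto_intros lim)
  then show "0 \<le> (\<Sum>i<n. \<Sum>j<n. c i * c j * f (g i - g j))"
    using \<open>L \<noteq> bot\<close> real_positive_definite_sum_ge_0[OF h]
    by (intro tendsto_lowerbound[OF _ always_eventually]) auto
qed

section \<open>Averages over finitely many translates\<close>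

text \<open>This is the convolution of \<open>f\<close> with \<mu> and with the reflection of \<mu>,
  where \<mu> is the uniform probability measure on the entries of \<open>xs\<close>. Lists count
  points with multiplicity, so overlapping lists can be joined. The empty list gives 0.\<close>

definition list_average :: "'a::ab_group_add list \<Rightarrow> ('a \<Rightarrow> real) \<Rightarrow> 'a \<Rightarrow> real" where
  "list_average xs f z = (\<Sum>a\<leftarrow>xs. \<Sum>b\<leftarrow>xs. f (z + a - b)) / (real (length xs))\<^sup>2"

lemma list_average_conv_sum:
  "list_average xs f z
    = (\<Sum>k<length xs. \<Sum>l<length xs. f (z + xs ! k - xs ! l)) / (real (length xs))\<^sup>2"
  by (simp add: list_average_def sum_list_sum_nth atLeast0LessThan)

text \<open>Positivity of the average is positivity of the form of \<open>f\<close> at the points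
  \<open>g i + xs ! k\<close>, indexed by the pairs \<open>(i, k)\<close>.\<close>

lemma real_positive_definite_list_average:
  assumes f: "real_positive_definite f"
  shows "real_positive_definite (list_average xs f)"
  unfolding real_positive_definite_def
proof (intro conjI allI)
  let ?m = "length xs"
  fix x
  have "(\<Sum>k<?m. \<Sum>l<?m. f (- x + xs ! k - xs ! l)) = (\<Sum>k<?m. \<Sum>l<?m. f (x + xs ! l - xs ! k))"
  proof (intro sum.cong refl)
    fix k l
    show "f (- x + xs ! k - xs ! l) = f (x + xs ! l - xs ! k)"
      using real_positive_definite_minus[OF f, of "x + xs ! l - xs ! k"]
      by (simp add: algebra_simps)
  qed
  also have "\<dots> = (\<Sum>k<?m. \<Sum>l<?m. f (x + xs ! k - xs ! l))"
    by (rule sum.swap)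
  finally show "list_average xs f (- x) = list_average xs f x"
    by (simp add: list_average_conv_sum)
next
  let ?m = "length xs"
  fix n :: nat and c :: "nat \<Rightarrow> real" and g :: "nat \<Rightarrow> 'a"
  let ?I = "{..<n} \<times> {..<?m}"
  have "0 \<le> (\<Sum>p\<in>?I. \<Sum>q\<in>?I. c (fst p) * c (fst q)
      * f ((g (fst p) + xs ! snd p) - (g (fst q) + xs ! snd q)))"
    by (rule real_positive_definite_finite_sum_ge_0[OF f]) simp
  also have "\<dots> = (\<Sum>i<n. \<Sum>k<?m. \<Sum>j<n. \<Sum>l<?m. c i * c j * f (g i - g j + xs ! k - xs ! l))"
    by (simp add: sum.cartesian_product' algebra_simps)
  also have "\<dots> = (\<Sum>i<n. \<Sum>j<n. \<Sum>k<?m. \<Sum>l<?m. c i * c j * f (g i - g j + xs ! k - xs ! l))"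
    by (intro sum.cong refl sum.swap)
  finally have "0 \<le> (\<Sum>i<n. \<Sum>j<n. \<Sum>k<?m. \<Sum>l<?m. c i * c j * f (g i - g j + xs ! k - xs ! l))" .
  moreover have "(\<Sum>i<n. \<Sum>j<n. c i * c j * list_average xs f (g i - g j))
      = (\<Sum>i<n. \<Sum>j<n. \<Sum>k<?m. \<Sum>l<?m. c i * c j * f (g i - g j + xs ! k - xs ! l)) / (real ?m)\<^sup>2"
    by (simp add: list_average_conv_sum sum_divide_distrib sum_distrib_left)
  ultimately show "0 \<le> (\<Sum>i<n. \<Sum>j<n. c i * c j * list_average xs f (g i - g j))"
    by simp
qed

text \<open>The doubled list yields four blocks of differences: two give the sum at 0, the others
  the sums at \<open>z\<close> and \<open>- z\<close>, which agree by symmetry. So a lower bound for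
  the doubled list limits the drop of the average from 0 to \<open>z\<close>.\<close>

lemma list_average_append_translate:
  assumes f: "real_positive_definite f"
  shows "2 * list_average (xs @ map (\<lambda>a. z + a) xs) f 0 = list_average xs f 0 + list_average xs f z"
proof (cases "xs = []")
  case False
  let ?S = "\<lambda>u. \<Sum>a\<leftarrow>xs. \<Sum>b\<leftarrow>xs. f (u + a - b)"
  have sym: "?S (- z) = ?S z"
    using real_positive_definite_minus[OF real_positive_definite_list_average[OF f, of xs], of z] False
    by (simp add: list_average_def)
  have "(\<Sum>a\<leftarrow>xs @ map (\<lambda>a. z + a) xs. \<Sum>b\<leftarrow>xs @ map (\<lambda>a. z + a) xs. f (0 + a - b))
      = 2 * ?S 0 + ?S z + ?S (- z)"
    by (simp add: o_def sum_list_addf algebra_simps)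
  then show ?thesis
    using False sym by (simp add: list_average_def field_simps power2_eq_square)
qed (simp add: list_average_def)

section \<open>Compactness: cluster points of functions and small translates of compact sets\<close>

text \<open>Tychonoff's theorem for the product of the intervals \<open>{-B..B}\<close>. Such a
  product need not be sequentially compact, so the limit is taken along a filter refining
  \<open>sequentially\<close> instead of a subsequence.\<close>

lemma bounded_functions_cluster_point:
  fixes h :: "nat \<Rightarrow> 'a \<Rightarrow> real"
  assumes "\<And>n x. \<bar>h n x\<bar> \<le> B"
  obtains f L where "L \<noteq> bot" "L \<le> sequentially" "\<And>x. ((\<lambda>n. h n x) \<longlongrightarrow> f x) L"
proof -
  let ?X = "PiE UNIV (\<lambda>_::'a. {-B..B})"
  have "compactin (product_topology (\<lambda>_. euclidean) UNIV) ?X"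
    by (simp add: compactin_PiE)
  then have "compact ?X"
    by (simp add: euclidean_product_topology)
  moreover have "eventually (\<lambda>f. f \<in> ?X) (filtermap h sequentially)"
    using assms by (auto simp: eventually_filtermap abs_le_iff minus_le_iff intro!: always_eventually)
  ultimately obtain f where "inf (nhds f) (filtermap h sequentially) \<noteq> bot"
    unfolding compact_filter by (metis filtermap_bot_iff sequentially_bot)
  \<comment> \<open>The cluster property in elementary terms: every neighbourhood of
    \<open>f\<close> is visited at arbitrarily late indices.\<close>
  have f: "\<exists>n. Q (h n) \<and> R n" if "eventually Q (nhds f)" "eventually R sequentially" for Q R
  proof (rule ccontr)
    assume "\<nexists>n. Q (h n) \<and> R n"
    then have "eventually (\<lambda>g. \<not> Q g) (filtermap h sequentially)"
      using that(2) by (auto simp: eventually_filtermap elim: eventually_mono)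
    then have "eventually (\<lambda>_. False) (inf (nhds f) (filtermap h sequentially))"
      using that(1) unfolding eventually_inf by blast
    with \<open>inf (nhds f) (filtermap h sequentially) \<noteq> bot\<close> show False
      by (simp add: trivial_limit_def)
  qed
  \<comment> \<open>The preimages of neighbourhoods of \<open>f\<close> are adjoined to the tails;
    the preceding fact keeps this filter proper.\<close>
  define L where "L = inf sequentially (filtercomap h (nhds f))"
  show thesis
  proof
    show "L \<noteq> bot"
      unfolding L_def trivial_limit_def eventually_inf eventually_filtercomap
      using f by metis
    show "L \<le> sequentially"
      by (simp add: L_def)
    have "filterlim h (nhds f) L"
      unfolding L_def by (meson filterlim_filtercomap filterlim_mono inf_le2 order_refl)
    then show "((\<lambda>n. h n x) \<longlongrightarrow> f x) L" for x
      using continuous_on_tendsto_compose[OF continuous_on_product_coordinates[of x]] by simp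
  qed
qed

text \<open>The tube lemma, applied to the preimage of \<open>V\<close> under subtraction, makes one
  \<open>U\<close> work for all of \<open>K\<close>.\<close>

lemma compact_subset_open_translate:
  fixes K V :: "'a::topological_ab_group_add set"
  assumes "compact K" "open V" "K \<subseteq> V"
  obtains U where "open U" "0 \<in> U" "\<And>u x. u \<in> U \<Longrightarrow> x \<in> K \<Longrightarrow> x - u \<in> V"
proof -
  let ?W = "(\<lambda>p::'a \<times> 'a. snd p - fst p) -` V"
  have "open ?W"
    by (rule open_vimage[OF \<open>open V\<close>]) (intro continuous_intros)
  moreover have "{0} \<times> K \<subseteq> ?W"
    using \<open>K \<subseteq> V\<close> by auto
  ultimately obtain U where U: "0 \<in> U" "open U" "U \<times> K \<subseteq> ?W"
    using Elementary_Topology.tube_lemma[OF \<open>compact K\<close>, of ?W 0] by metis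
  show thesis
  proof (rule that[OF U(2,1)])
    fix u x assume "u \<in> U" "x \<in> K"
    then have "(u, x) \<in> ?W"
      using U(3) by (meson SigmaI subsetD)
    then show "x - u \<in> V" by simp
  qed
qed

section \<open>Haar measure: invariance and continuity of translation in L1\<close>

locale haar =
  fixes M :: "'a::{topological_ab_group_add, t2_space} measure"
  assumes haar_measure: "haar_measure M"
begin

lemma sets_M [measurable_cong]: "sets M = sets borel"
  using haar_measure[unfolded haar_measure_def, THEN conjunct1] .

lemma space_M [simp]: "space M = UNIV"
  using sets_eq_imp_space_eq[OF sets_M] by simp

lemma emeasure_translate: "A \<in> sets M \<Longrightarrow> emeasure M ((\<lambda>y. x + y) ` A) = emeasure M A"
  using haar_measure[unfolded haar_measure_def, THEN conjunct2, THEN conjunct1, rule_format] .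

lemma open_outer:
  assumes "A \<in> sets M" "emeasure M A < c"
  obtains U where "open U" "A \<subseteq> U" "emeasure M U < c"
proof -
  have "emeasure M A = (INF U\<in>{U. open U \<and> A \<subseteq> U}. emeasure M U)"
    using haar_measure[unfolded haar_measure_def, THEN conjunct2, THEN conjunct2, THEN conjunct2, THEN conjunct2, THEN conjunct1, rule_format, OF assms(1)] .
  then have "(INF U\<in>{U. open U \<and> A \<subseteq> U}. emeasure M U) < c"
    using assms(2) by (rule subst)
  then show thesis
    using that by (auto simp: INF_less_iff)
qed

lemma compact_inner:
  assumes "open U" "c < emeasure M U"
  obtains K where "compact K" "K \<subseteq> U" "c < emeasure M K"
proof -
  have "emeasure M U = (SUP K\<in>{K. compact K \<and> K \<subseteq> U}. emeasure M K)"
    using haar_measure[unfolded haar_measure_def, THEN conjunct2, THEN conjunct2, THEN conjunct2, THEN conjunct2, THEN conjunct2, rule_format, OF assms(1)] .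
  then have "c < (SUP K\<in>{K. compact K \<and> K \<subseteq> U}. emeasure M K)"
    using assms(2) by (rule subst)
  then show thesis
    using that by (auto simp: less_SUP_iff)
qed

lemma emeasure_open_pos: "open U \<Longrightarrow> U \<noteq> {} \<Longrightarrow> 0 < emeasure M U"
  using haar_measure[unfolded haar_measure_def, THEN conjunct2, THEN conjunct2, THEN conjunct2, THEN conjunct1] by blast

lemma borel_measurable_continuous: "continuous_on UNIV f \<Longrightarrow> f \<in> borel_measurable M"
  for f :: "'a \<Rightarrow> 'b::topological_space"
  by (subst measurable_cong_sets[OF sets_M refl]) (rule borel_measurable_continuous_onI)

lemma translate_measurable [measurable]: "(\<lambda>x. x + u) \<in> measurable M M"
proof -
  have "(\<lambda>x. x + u) \<in> borel_measurable (borel :: 'a measure)"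
    by (intro borel_measurable_continuous_onI continuous_intros)
  then show ?thesis
    by (subst measurable_cong_sets[OF sets_M sets_M])
qed

lemma distr_translate: "distr M M (\<lambda>x. x + u) = M"
proof (rule measure_eqI)
  fix A assume "A \<in> sets (distr M M (\<lambda>x. x + u))"
  then have A: "A \<in> sets M" by simp
  have "(\<lambda>x. x + u) -` A = (\<lambda>y. - u + y) ` A"
  proof (intro set_eqI iffI)
    fix x assume "x \<in> (\<lambda>x. x + u) -` A"
    then show "x \<in> (\<lambda>y. - u + y) ` A"
      by (intro image_eqI[of _ _ "x + u"]) auto
  qed auto
  then show "emeasure (distr M M (\<lambda>x. x + u)) A = emeasure M A"
    using A emeasure_translate[OF A, of "- u"] by (simp add: emeasure_distr del: minus_add_distrib)
qed simp

lemma integrable_translate: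
  fixes f :: "'a \<Rightarrow> real"
  assumes "integrable M f"
  shows "integrable M (\<lambda>x. f (x + u))"
  using assms integrable_distr[of "\<lambda>x. x + u" M M f] by (simp add: distr_translate)

lemma integral_translate:
  fixes f :: "'a \<Rightarrow> real"
  assumes "f \<in> borel_measurable M"
  shows "(\<integral>x. f (x + u) \<partial>M) = (\<integral>x. f x \<partial>M)"
  using assms integral_distr[of "\<lambda>x. x + u" M M f] by (simp add: distr_translate)

lemma AE_translate:
  assumes "AE x in M. P x"
  shows "AE x in M. P (x + u)"
  using AE_distrD[OF translate_measurable, of P u] assms unfolding distr_translate .

text \<open>Inner regularity is provided for open sets, so \<open>A\<close> is enclosed in an open
  \<open>V\<close>, and the compact \<open>K\<close> is chosen inside \<open>V\<close> rather than
  inside \<open>A\<close>. Both miss little of \<open>V\<close>, and small translates of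
  \<open>K\<close> stay in \<open>V\<close>.\<close>

lemma L1_translation_continuous_indicator:
  assumes A: "A \<in> sets M" "emeasure M A < \<infinity>" and "0 < \<epsilon>"
  obtains U where "open U" "0 \<in> U"
    "\<And>u. u \<in> U \<Longrightarrow> (\<integral>x. \<bar>indicator A (x + u) - indicator A x :: real\<bar> \<partial>M) \<le> \<epsilon>"
proof -
  have "emeasure M A < emeasure M A + ennreal (\<epsilon>/4)"
    using A(2) \<open>0 < \<epsilon>\<close> by (cases "emeasure M A") (auto simp: ennreal_less_iff simp flip: ennreal_plus)
  then obtain V where V: "open V" "A \<subseteq> V" "emeasure M V < emeasure M A + ennreal (\<epsilon>/4)"
    using open_outer[OF A(1)] by blast
  have Vfin: "emeasure M V < \<infinity>"
    using order_less_trans[OF V(3)] A(2) by (simp add: less_top)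
  have Vs: "V \<in> sets M"
    using V(1) by (simp add: sets_M)
  \<comment> \<open>If \<open>V\<close> is null, the truncated difference is not strictly below
    \<open>emeasure M V\<close>, and the empty set serves as \<open>K\<close>.\<close>
  have "\<exists>K. compact K \<and> K \<subseteq> V \<and> emeasure M V \<le> emeasure M K + ennreal (\<epsilon>/4)"
  proof (cases "emeasure M V = 0")
    case False
    then have "emeasure M V - ennreal (\<epsilon>/4) < emeasure M V"
      using Vfin \<open>0 < \<epsilon>\<close>
      by (cases "emeasure M V") (auto simp: ennreal_minus intro: ennreal_lessI)
    then obtain K where "compact K" "K \<subseteq> V" "emeasure M V - ennreal (\<epsilon>/4) < emeasure M K"
      using compact_inner[OF V(1)] by blast
    moreover from this(3) have "emeasure M V \<le> emeasure M K + ennreal (\<epsilon>/4)"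
      using less_imp_le ennreal_minus_le_iff add.commute by metis
    ultimately show ?thesis
      by blast
  qed (auto intro!: exI[of _ "{}"])
  then obtain K where K: "compact K" "K \<subseteq> V" "emeasure M V \<le> emeasure M K + ennreal (\<epsilon>/4)"
    by blast
  have Ks: "K \<in> sets M"
    using compact_imp_closed[OF K(1)] by (simp add: sets_M)
  have Kfin: "emeasure M K < \<infinity>"
    using order_le_less_trans[OF emeasure_mono[OF K(2) Vs] Vfin] .
  have eq: "emeasure M V = ennreal (measure M V)" "emeasure M A = ennreal (measure M A)"
    "emeasure M K = ennreal (measure M K)"
    using A(2) Vfin Kfin by (simp_all add: emeasure_eq_ennreal_measure)
  have "ennreal (measure M V) < ennreal (measure M A + \<epsilon>/4)"
    using V(3) \<open>0 < \<epsilon>\<close> unfolding eq by simp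
  then have mA: "measure M V \<le> measure M A + \<epsilon>/4"
    by (simp add: ennreal_less_iff)
  have "ennreal (measure M V) \<le> ennreal (measure M K + \<epsilon>/4)"
    using K(3) \<open>0 < \<epsilon>\<close> unfolding eq by simp
  then have mK: "measure M V \<le> measure M K + \<epsilon>/4"
    using \<open>0 < \<epsilon>\<close> by (subst (asm) ennreal_le_iff) auto
  obtain U where U: "open U" "0 \<in> U" "\<And>u x. u \<in> U \<Longrightarrow> x \<in> K \<Longrightarrow> x - u \<in> V"
    using compact_subset_open_translate[OF K(1) V(1) K(2)] by blast
  have int [simp]: "integrable M (indicator A :: _ \<Rightarrow> real)" "integrable M (indicator V :: _ \<Rightarrow> real)"
    "integrable M (indicator K :: _ \<Rightarrow> real)"
    using A Vs Vfin Ks Kfin by (auto simp: integrable_indicator_iff)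
  note intu [simp] = int[THEN integrable_translate]
  have [simp]: "(\<integral>x. indicator B (x + u) \<partial>M) = measure M B" if "B \<in> sets M" for B u
    using integral_translate[of "indicator B" u] that by simp
  show thesis
  proof (rule that[OF U(1,2)])
    fix u assume "u \<in> U"
    \<comment> \<open>The comparison runs from \<open>A\<close> through \<open>V\<close> and
      \<open>K\<close> at \<open>x + u\<close>, then through \<open>V\<close> to \<open>A\<close> at
      \<open>x\<close>. Each bracket is nonnegative, the third because \<open>x + u\<close> in
      \<open>K\<close> puts \<open>x\<close> in \<open>V\<close>; by invariance each has integral at
      most \<open>\<epsilon>/4\<close>.\<close>
    have *: "\<bar>indicator A (x + u) - indicator A x :: real\<bar>
      \<le> (indicator V (x + u) - indicator A (x + u)) + (indicator V (x + u) - indicator K (x + u))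
        + (indicator V x - indicator K (x + u)) + (indicator V x - indicator A x)" for x
      using U(3)[OF \<open>u \<in> U\<close>, of "x + u"] V(2) K(2) by (auto simp: indicator_def)
    have "(\<integral>x. \<bar>indicator A (x + u) - indicator A x :: real\<bar> \<partial>M)
      \<le> (\<integral>x. ((indicator V (x + u) - indicator A (x + u)) + (indicator V (x + u) - indicator K (x + u))
        + (indicator V x - indicator K (x + u)) + (indicator V x - indicator A x) :: real) \<partial>M)"
      by (intro integral_mono integrable_abs Bochner_Integration.integrable_add
          Bochner_Integration.integrable_diff intu int *)
    also have "\<dots> = (measure M V - measure M A) + (measure M V - measure M K)
        + (measure M V - measure M K) + (measure M V - measure M A)"
      using A(1) Vs Ks by simp
    also have "\<dots> \<le> \<epsilon>"
      using mA mK by simp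
    finally show "(\<integral>x. \<bar>indicator A (x + u) - indicator A x :: real\<bar> \<partial>M) \<le> \<epsilon>" .
  qed
qed

text \<open>Indicators, sums and dominated limits are treated in turn. In the limit case invariance
  makes the approximation error the same before and after translation.\<close>

lemma L1_translation_continuous:
  fixes f :: "'a \<Rightarrow> real"
  assumes "integrable M f" "0 < \<epsilon>"
  shows "\<exists>U. open U \<and> 0 \<in> U \<and> (\<forall>u\<in>U. (\<integral>x. \<bar>f (x + u) - f x\<bar> \<partial>M) \<le> \<epsilon>)"
  using assms
proof (induction arbitrary: \<epsilon> rule: integrable_induct)
  case (base A c)
  \<comment> \<open>The denominator \<open>\<bar>c\<bar> + 1\<close> also covers
    \<open>c = 0\<close>.\<close>
  have "0 < \<epsilon> / (\<bar>c\<bar> + 1)"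
    using base(3) by (intro divide_pos_pos) auto
  then obtain U where U: "open U" "0 \<in> U"
    "\<And>u. u \<in> U \<Longrightarrow> (\<integral>x. \<bar>indicator A (x + u) - indicator A x :: real\<bar> \<partial>M) \<le> \<epsilon> / (\<bar>c\<bar> + 1)"
    using L1_translation_continuous_indicator[OF base(1,2)] by blast
  have "(\<integral>x. \<bar>indicator A (x + u) *\<^sub>R c - indicator A x *\<^sub>R c\<bar> \<partial>M) \<le> \<epsilon>" if "u \<in> U" for u
  proof -
    have "(\<integral>x. \<bar>indicator A (x + u) *\<^sub>R c - indicator A x *\<^sub>R c\<bar> \<partial>M)
        = (\<integral>x. \<bar>indicator A (x + u) - indicator A x :: real\<bar> \<partial>M) * \<bar>c\<bar>"
      by (simp add: abs_mult flip: left_diff_distrib)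
    also have "\<dots> \<le> \<epsilon> / (\<bar>c\<bar> + 1) * (\<bar>c\<bar> + 1)"
      using base(3) by (intro mult_mono U(3) that) auto
    finally show ?thesis by simp
  qed
  with U(1,2) show ?case by blast
next
  case (add f g)
  obtain U V where UV: "open U" "0 \<in> U" "open V" "0 \<in> V"
    "\<And>u. u \<in> U \<Longrightarrow> (\<integral>x. \<bar>f (x + u) - f x\<bar> \<partial>M) \<le> \<epsilon>/2"
    "\<And>u. u \<in> V \<Longrightarrow> (\<integral>x. \<bar>g (x + u) - g x\<bar> \<partial>M) \<le> \<epsilon>/2"
    using add.IH(1)[of "\<epsilon>/2"] add.IH(2)[of "\<epsilon>/2"] add.prems by auto
  note int = integrable_translate[OF add.hyps(1)] integrable_translate[OF add.hyps(2)] add.hyps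
  have "(\<integral>x. \<bar>(f (x + u) + g (x + u)) - (f x + g x)\<bar> \<partial>M) \<le> \<epsilon>" if "u \<in> U \<inter> V" for u
  proof -
    have "(\<integral>x. \<bar>(f (x + u) + g (x + u)) - (f x + g x)\<bar> \<partial>M)
        \<le> (\<integral>x. \<bar>f (x + u) - f x\<bar> + \<bar>g (x + u) - g x\<bar> \<partial>M)"
      by (intro integral_mono Bochner_Integration.integrable_add Bochner_Integration.integrable_diff
          integrable_abs int) linarith
    also have "\<dots> = (\<integral>x. \<bar>f (x + u) - f x\<bar> \<partial>M) + (\<integral>x. \<bar>g (x + u) - g x\<bar> \<partial>M)"
      by (intro Bochner_Integration.integral_add Bochner_Integration.integrable_diff
          integrable_abs int)
    also have "\<dots> \<le> \<epsilon>"
      using UV(5,6)[of u] that by auto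
    finally show ?thesis .
  qed
  with UV(1-4) show ?case by (intro exI[of _ "U \<inter> V"]) auto
next
  case (lim f s)
  \<comment> \<open>The induction rule provides approximants bounded by
    \<open>2 * \<bar>f x\<bar>\<close>, whence the factor 3 in the majorant.\<close>
  have "(\<lambda>i. \<integral>x. \<bar>s i x - f x\<bar> \<partial>M) \<longlonglongrightarrow> (\<integral>x. 0 \<partial>M)"
  proof (rule integral_dominated_convergence[where w = "\<lambda>x. 3 * \<bar>f x\<bar>"])
    show "AE x in M. (\<lambda>i. \<bar>s i x - f x\<bar>) \<longlonglongrightarrow> 0"
      by (intro AE_I2 tendsto_rabs_zero LIM_zero lim.hyps(2))
    show "AE x in M. norm \<bar>s i x - f x\<bar> \<le> 3 * \<bar>f x\<bar>" for i
    proof (rule AE_I2)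
      fix x assume "x \<in> space M"
      then show "norm \<bar>s i x - f x\<bar> \<le> 3 * \<bar>f x\<bar>"
        using lim.hyps(3)[of x i] abs_triangle_ineq4[of "s i x" "f x"] by simp
    qed
  qed (use lim.hyps(1,4) in auto)
  then have "eventually (\<lambda>i. (\<integral>x. \<bar>s i x - f x\<bar> \<partial>M) < \<epsilon>/4) sequentially"
    using lim.prems by (intro order_tendstoD) auto
  then obtain i where i: "(\<integral>x. \<bar>s i x - f x\<bar> \<partial>M) < \<epsilon>/4"
    using eventually_happens'[OF sequentially_bot] by blast
  obtain U where U: "open U" "0 \<in> U"
    "\<And>u. u \<in> U \<Longrightarrow> (\<integral>x. \<bar>s i (x + u) - s i x\<bar> \<partial>M) \<le> \<epsilon>/2"
    using lim.IH[of "\<epsilon>/2" i] lim.prems by auto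
  note int = integrable_translate[OF lim.hyps(1)[of i]] integrable_translate[OF lim.hyps(4)]
    lim.hyps(1)[of i] lim.hyps(4)
  have "(\<integral>x. \<bar>f (x + u) - f x\<bar> \<partial>M) \<le> \<epsilon>" if "u \<in> U" for u
  proof -
    have "(\<integral>x. \<bar>f (x + u) - f x\<bar> \<partial>M)
        \<le> (\<integral>x. \<bar>s i (x + u) - f (x + u)\<bar> + \<bar>s i (x + u) - s i x\<bar> + \<bar>s i x - f x\<bar> \<partial>M)"
      by (intro integral_mono Bochner_Integration.integrable_add Bochner_Integration.integrable_diff
          integrable_abs int) linarith
    also have "\<dots> = (\<integral>x. \<bar>s i (x + u) - f (x + u)\<bar> \<partial>M) + (\<integral>x. \<bar>s i (x + u) - s i x\<bar> \<partial>M)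
        + (\<integral>x. \<bar>s i x - f x\<bar> \<partial>M)"
      using int by simp
    also have "(\<integral>x. \<bar>s i (x + u) - f (x + u)\<bar> \<partial>M) = (\<integral>x. \<bar>s i x - f x\<bar> \<partial>M)"
      using int by (intro integral_translate[of "\<lambda>x. \<bar>s i x - f x\<bar>"]) auto
    finally show ?thesis
      using i U(3)[OF that] by simp
  qed
  with U(1,2) show ?case by blast
qed

end

section \<open>Small neighbourhoods of 0, suprema of infima, almost everywhere convergence\<close>

lemma open_diff_neighbourhood:
  fixes V :: "'a::topological_ab_group_add set"
  assumes "open V" "0 \<in> V"
  obtains U where "open U" "0 \<in> U" "\<And>x y. x \<in> U \<Longrightarrow> y \<in> U \<Longrightarrow> x - y \<in> V"
proof -
  let ?W = "(\<lambda>p::'a \<times> 'a. fst p - snd p) -` V"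
  have "open ?W"
    by (rule open_vimage[OF \<open>open V\<close>]) (intro continuous_intros)
  moreover have "(0, 0) \<in> ?W"
    using \<open>0 \<in> V\<close> by simp
  ultimately obtain A B where AB: "open A" "open B" "(0, 0) \<in> A \<times> B" "A \<times> B \<subseteq> ?W"
    unfolding open_prod_def by meson
  show thesis
  proof (rule that[of "A \<inter> B"])
    fix x y assume "x \<in> A \<inter> B" "y \<in> A \<inter> B"
    then have "(x, y) \<in> ?W"
      using AB(4) by (meson IntD1 IntD2 SigmaI subsetD)
    then show "x - y \<in> V" by simp
  qed (use AB in auto)
qed

lemma continuous_on_uniform_translate:
  fixes h :: "'a::topological_ab_group_add \<Rightarrow> real"
  assumes "\<And>\<epsilon>. 0 < \<epsilon> \<Longrightarrow> \<exists>U. open U \<and> 0 \<in> U \<and> (\<forall>x y. x - y \<in> U \<longrightarrow> \<bar>h x - h y\<bar> < \<epsilon>)"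
  shows "continuous_on UNIV h"
proof -
  have "(h \<longlongrightarrow> h y) (at y)" for y
  proof (rule tendstoI)
    fix \<epsilon> :: real assume "0 < \<epsilon>"
    then obtain U where U: "open U" "0 \<in> U" "\<And>x. x - y \<in> U \<Longrightarrow> \<bar>h x - h y\<bar> < \<epsilon>"
      using assms[OF \<open>0 < \<epsilon>\<close>] by metis
    have "open ((\<lambda>x. x - y) -` U)"
      by (rule open_vimage[OF U(1)]) (intro continuous_intros)
    then show "\<forall>\<^sub>F x in at y. dist (h x) (h y) < \<epsilon>"
      unfolding eventually_at_topological dist_real_def using U(2,3)
      by (intro exI[of _ "(\<lambda>x. x - y) -` U"] conjI ballI impI) simp_all
  qed
  then show ?thesis
    by (simp add: continuous_on_def)
qed

text \<open>The number \<open>s\<close> is the supremum of the infima of \<open>Q\<close> over the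
  sets \<open>A i\<close>. It serves twice: for nearly minimal L2 norms of almost maximal functions,
  and for nearly minimal averages near 0.\<close>

lemma SUP_INF_approx:
  fixes Q :: "'b \<Rightarrow> real"
  assumes "I \<noteq> {}" and ne: "\<And>i. i \<in> I \<Longrightarrow> A i \<noteq> {}"
    and Q: "\<And>i x. i \<in> I \<Longrightarrow> x \<in> A i \<Longrightarrow> 0 \<le> Q x" "\<And>i x. i \<in> I \<Longrightarrow> x \<in> A i \<Longrightarrow> Q x \<le> B"
  shows "\<exists>s. (\<forall>i\<in>I. \<forall>\<epsilon>>0. \<exists>x\<in>A i. Q x < s + \<epsilon>) \<and> (\<forall>\<epsilon>>0. \<exists>i\<in>I. \<forall>x\<in>A i. s - \<epsilon> < Q x)"
proof -
  define q where "q i = (INF x\<in>A i. Q x)" for i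
  have bdd: "bdd_below (Q ` A i)" if "i \<in> I" for i
    using Q(1) that by (intro bdd_belowI[of _ 0]) auto
  have "q i \<le> B" if "i \<in> I" for i
  proof -
    obtain x where "x \<in> A i"
      using ne[OF \<open>i \<in> I\<close>] by auto
    then show ?thesis
      unfolding q_def using Q(2)[OF that] cINF_lower2[OF bdd[OF that]] by blast
  qed
  then have bdda: "bdd_above (q ` I)"
    by (intro bdd_aboveI[of _ B]) auto
  show ?thesis
  proof (intro exI[of _ "SUP i\<in>I. q i"] conjI ballI allI impI)
    fix i and \<epsilon> :: real assume "i \<in> I" "0 < \<epsilon>"
    then have "q i < (SUP i\<in>I. q i) + \<epsilon>"
      using cSUP_upper[OF \<open>i \<in> I\<close> bdda] by simp
    then show "\<exists>x\<in>A i. Q x < (SUP i\<in>I. q i) + \<epsilon>"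
      using cINF_less_iff[OF ne[OF \<open>i \<in> I\<close>] bdd[OF \<open>i \<in> I\<close>]] by (simp add: q_def)
  next
    fix \<epsilon> :: real assume "0 < \<epsilon>"
    then have "(SUP i\<in>I. q i) - \<epsilon> < (SUP i\<in>I. q i)" by simp
    then obtain i where i: "i \<in> I" "(SUP i\<in>I. q i) - \<epsilon> < q i"
      using less_cSUP_iff[OF \<open>I \<noteq> {}\<close> bdda] by auto
    have "(SUP i\<in>I. q i) - \<epsilon> < Q x" if "x \<in> A i" for x
      using i(2) cINF_lower[OF bdd[OF i(1)] that] by (simp add: q_def)
    then show "\<exists>i\<in>I. \<forall>x\<in>A i. (SUP i\<in>I. q i) - \<epsilon> < Q x"
      using i(1) by blast
  qed
qed

text \<open>The squared increments weighted by \<open>2^k\<close> have a sum with finite integral,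
  which is therefore finite almost everywhere. The inequality of arithmetic and geometric means
  turns this into absolute summability of the increments, also on spaces of infinite
  measure.\<close>

lemma AE_convergent_L2:
  fixes f :: "nat \<Rightarrow> 'a \<Rightarrow> real"
  assumes [measurable]: "\<And>k. f k \<in> borel_measurable M"
    and int: "\<And>k. integrable M (\<lambda>x. (f (Suc k) x - f k x)\<^sup>2)"
    and le: "\<And>k. (\<integral>x. (f (Suc k) x - f k x)\<^sup>2 \<partial>M) \<le> B * (1/4)^k"
  shows "AE x in M. convergent (\<lambda>k. f k x)"
proof -
  let ?u = "\<lambda>k x. 2^k * (f (Suc k) x - f k x)\<^sup>2"
  have "0 \<le> B"
    using order_trans[OF integral_nonneg_AE le[of 0]] by simp
  have "(\<integral>\<^sup>+x. ennreal (?u k x) \<partial>M) \<le> ennreal (B * (1/2)^k)" for k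
  proof -
    have "(\<integral>\<^sup>+x. ennreal (?u k x) \<partial>M) = ennreal (\<integral>x. ?u k x \<partial>M)"
      using int by (intro nn_integral_eq_integral) auto
    also have "(\<integral>x. ?u k x \<partial>M) = 2^k * (\<integral>x. (f (Suc k) x - f k x)\<^sup>2 \<partial>M)"
      by simp
    also have "\<dots> \<le> 2^k * (B * (1/4)^k)"
      by (intro mult_left_mono le) simp
    also have "\<dots> = B * (1/2)^k"
      using power_mult_distrib[of 2 "1/4::real" k] by simp
    finally show ?thesis
      by (simp add: ennreal_leI)
  qed
  then have "(\<Sum>k. \<integral>\<^sup>+x. ennreal (?u k x) \<partial>M) \<le> (\<Sum>k. ennreal (B * (1/2)^k))"
    by (intro suminf_le) auto
  also have "\<dots> = ennreal (\<Sum>k. B * (1/2)^k)"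
    using \<open>0 \<le> B\<close> by (intro suminf_ennreal2 summable_mult summable_geometric) auto
  finally have "(\<integral>\<^sup>+x. (\<Sum>k. ennreal (?u k x)) \<partial>M) \<noteq> \<infinity>"
    by (subst nn_integral_suminf) (auto simp: top_unique)
  then have "AE x in M. (\<Sum>k. ennreal (?u k x)) \<noteq> \<infinity>"
    by (intro nn_integral_PInf_AE) auto
  then show ?thesis
  proof eventually_elim
    case (elim x)
    then have "summable (\<lambda>k. ?u k x)"
      by (intro summable_suminf_not_top) auto
    then have "summable (\<lambda>k. (1/2)^k + ?u k x)"
      by (intro summable_add summable_geometric) auto
    moreover have "norm (f (Suc k) x - f k x) \<le> (1/2)^k + ?u k x" for k
    proof -
      let ?d = "\<bar>f (Suc k) x - f k x\<bar>"
      \<comment> \<open>Centring the square at \<open>(1/2)^k\<close> makes the linear term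
        \<open>2 * ?d\<close>, free of powers depending on \<open>k\<close>.\<close>
      have "0 \<le> 2^k * (?d - (1/2)^k)\<^sup>2"
        by simp
      also have "\<dots> = ?u k x - 2 * ?d + (1/2)^k"
        by (simp add: power2_eq_square algebra_simps power_one_over flip: abs_mult)
      finally have "2 * ?d \<le> (1/2)^k + ?u k x"
        by simp
      then show ?thesis
        unfolding real_norm_def by (rule order_trans[rotated]) simp
    qed
    ultimately have "summable (\<lambda>k. f (Suc k) x - f k x)"
      by (rule summable_comparison_test'[where N = 0])
    then have "convergent (\<lambda>n. \<Sum>k<n. f (Suc k) x - f k x)"
      by (simp add: summable_iff_convergent)
    then have "convergent (\<lambda>n. f n x - f 0 x)"
      unfolding sum_lessThan_telescope[of "\<lambda>k. f k x"] .
    then show "convergent (\<lambda>n. f n x)"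
      using convergent_diff_const_right_iff by blast
  qed
qed

section \<open>The extremal class and a member with positive integral\<close>

locale turan = haar M for M :: "'a::{topological_ab_group_add, t2_space} measure" +
  fixes \<Omega> :: "'a set"
  assumes closed_\<Omega>: "closed \<Omega>" and zero_interior: "0 \<in> interior \<Omega>"
    and finite_\<Omega>: "emeasure M \<Omega> < \<infinity>"
begin

lemma turan_class_iff:
  "f \<in> turan_class M \<Omega> \<longleftrightarrow> continuous_on UNIV f \<and> real_positive_definite f \<and> f 0 = 1 \<and>
     integrable M f \<and> (\<forall>x. x \<notin> \<Omega> \<longrightarrow> f x \<le> 0)"
proof -
  have "supp (pos_part f) \<subseteq> \<Omega> \<longleftrightarrow> {g. pos_part f g \<noteq> 0} \<subseteq> \<Omega>"
    unfolding supp_def using closure_minimal[OF _ closed_\<Omega>] closure_subset order_trans by metis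
  also have "\<dots> \<longleftrightarrow> (\<forall>x. x \<notin> \<Omega> \<longrightarrow> f x \<le> 0)"
    by (auto simp: pos_part_def max_def)
  finally show ?thesis
    by (auto simp: turan_class_def P1_def positive_definite_of_real_iff)
qed

lemma \<Omega>_sets [measurable]: "\<Omega> \<in> sets M"
  using closed_\<Omega> by (simp add: sets_M)

lemma integrable_indicator_\<Omega>: "integrable M (indicator \<Omega> :: 'a \<Rightarrow> real)"
  using finite_\<Omega> by simp

lemma turan_class_abs_le: "f \<in> turan_class M \<Omega> \<Longrightarrow> \<bar>f x\<bar> \<le> 1"
  using real_positive_definite_abs_le[of f x] by (simp add: turan_class_iff)

text \<open>This common integrable majorant bounds the integrals and later supplies the nonnegative
  functions for Fatou's lemma.\<close>

lemma turan_class_le_indicator: "f \<in> turan_class M \<Omega> \<Longrightarrow> f x \<le> indicator \<Omega> x"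
  using turan_class_abs_le[of f x] by (cases "x \<in> \<Omega>") (auto simp: turan_class_iff)

lemma turan_class_integrable: "f \<in> turan_class M \<Omega> \<Longrightarrow> integrable M f"
  by (simp add: turan_class_iff)

lemma turan_class_integral_le: "f \<in> turan_class M \<Omega> \<Longrightarrow> (\<integral>x. f x \<partial>M) \<le> measure M \<Omega>"
  using integral_mono[OF turan_class_integrable integrable_indicator_\<Omega> turan_class_le_indicator]
  by simp

lemma turan_class_midpoint:
  assumes "f \<in> turan_class M \<Omega>" "g \<in> turan_class M \<Omega>"
  shows "(\<lambda>x. (f x + g x) / 2) \<in> turan_class M \<Omega>"
  using assms real_positive_definite_midpoint[of f g]
  by (auto simp: turan_class_iff intro!: continuous_intros intro: add_nonpos_nonpos)

text \<open>The normalised autocorrelation of the indicator of a small neighbourhood of 0.\<close>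

lemma turan_class_positive_integral: "\<exists>h\<in>turan_class M \<Omega>. 0 < (\<integral>x. h x \<partial>M)"
proof -
  \<comment> \<open>Since \<open>W - W\<close> lies in \<Omega>, the autocorrelation of
    \<open>W\<close> vanishes outside \<Omega>.\<close>
  obtain W where W: "open W" "0 \<in> W" "\<And>x y. x \<in> W \<Longrightarrow> y \<in> W \<Longrightarrow> x - y \<in> interior \<Omega>"
    using open_diff_neighbourhood[OF open_interior zero_interior] by blast
  have W_sub: "W \<subseteq> \<Omega>"
    using W(3)[OF _ W(2)] interior_subset by auto
  have [measurable]: "W \<in> sets M"
    using W(1) by (simp add: sets_M)
  define \<phi> :: "'a \<Rightarrow> real" where "\<phi> = indicator W"
  have [measurable]: "\<phi> \<in> borel_measurable M"
    by (simp add: \<phi>_def)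
  have W_fin: "emeasure M W < \<infinity>"
    using order_le_less_trans[OF emeasure_mono[OF W_sub \<Omega>_sets] finite_\<Omega>] .
  then have int_\<phi>: "integrable M \<phi>"
    by (simp add: \<phi>_def)
  define m where "m = measure M W"
  have "0 < m"
    using emeasure_open_pos[OF W(1)] W(2) W_fin
    by (auto simp: m_def measure_def enn2real_positive_iff)
  have \<phi>01: "0 \<le> \<phi> x" "\<phi> x \<le> 1" for x
    by (auto simp: \<phi>_def)
  have int2: "integrable M (\<lambda>y. \<phi> (y + a) * \<phi> (y + b))" for a b
  proof (rule Bochner_Integration.integrable_bound[OF integrable_translate[OF int_\<phi>, of a]])
    show "AE y in M. norm (\<phi> (y + a) * \<phi> (y + b)) \<le> norm (\<phi> (y + a))"
      using \<phi>01 by (auto simp: abs_mult intro: mult_right_le_one_le)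
  qed measurable
  define h where "h x = (\<integral>y. \<phi> y * \<phi> (y + x) \<partial>M) / m" for x
  \<comment> \<open>Shifting the variable by \<open>b\<close> separates \<open>a\<close> from
    \<open>b\<close>, so that the quadratic form below becomes the integral of a square, divided by
    \<open>m\<close>.\<close>
  have h_shift: "h (a - b) = (\<integral>y. \<phi> (y + b) * \<phi> (y + a) \<partial>M) / m" for a b
  proof -
    have "(\<integral>y. \<phi> (y + b) * \<phi> (y + b + (a - b)) \<partial>M) = (\<integral>y. \<phi> y * \<phi> (y + (a - b)) \<partial>M)"
      using borel_measurable_integrable[OF int2[of 0 "a - b"]] by (intro integral_translate) simp
    moreover have "y + b + (a - b) = y + a" for y
      by simp
    ultimately show ?thesis
      by (simp add: h_def)
  qed
  have pd: "real_positive_definite h"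
    unfolding real_positive_definite_def
  proof (intro conjI allI)
    show "h (- x) = h x" for x
      using h_shift[of 0 x] by (simp add: h_def mult.commute)
    fix n :: nat and c :: "nat \<Rightarrow> real" and g :: "nat \<Rightarrow> 'a"
    have "(\<Sum>i<n. \<Sum>j<n. c i * c j * h (g i - g j))
        = (\<Sum>i<n. \<Sum>j<n. (\<integral>y. c i * c j * (\<phi> (y + g j) * \<phi> (y + g i)) \<partial>M)) / m"
      by (simp add: h_shift sum_divide_distrib)
    also have "(\<Sum>i<n. \<Sum>j<n. (\<integral>y. c i * c j * (\<phi> (y + g j) * \<phi> (y + g i)) \<partial>M))
        = (\<integral>y. (\<Sum>i<n. \<Sum>j<n. c i * c j * (\<phi> (y + g j) * \<phi> (y + g i))) \<partial>M)"
      using int2 by (subst Bochner_Integration.integral_sum;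
          (intro Bochner_Integration.integrable_sum integrable_mult_right int2 sum.cong refl)?)
        (subst Bochner_Integration.integral_sum; simp add: int2)
    also have "\<dots> = (\<integral>y. (\<Sum>i<n. c i * \<phi> (y + g i))\<^sup>2 \<partial>M)"
      by (simp add: power2_eq_square sum_product algebra_simps)
    finally show "0 \<le> (\<Sum>i<n. \<Sum>j<n. c i * c j * h (g i - g j))"
      using \<open>0 < m\<close> by simp
  qed
  have "h 0 = 1"
  proof -
    have "(\<lambda>y. \<phi> y * \<phi> (y + 0)) = indicator W"
      by (auto simp: \<phi>_def indicator_def)
    then show ?thesis
      using \<open>0 < m\<close> unfolding h_def by (simp add: m_def)
  qed
  have cont: "continuous_on UNIV h"
  proof (rule continuous_on_uniform_translate)
    fix \<epsilon> :: real assume "0 < \<epsilon>"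
    \<comment> \<open>The factor \<open>m\<close> compensates the normalisation of \<open>h\<close>,
      and the 2 makes the final inequality strict.\<close>
    then obtain U where U: "open U" "0 \<in> U"
      "\<And>u. u \<in> U \<Longrightarrow> (\<integral>y. \<bar>\<phi> (y + u) - \<phi> y\<bar> \<partial>M) \<le> \<epsilon> * m / 2"
      using L1_translation_continuous[OF int_\<phi>, of "\<epsilon> * m / 2"] \<open>0 < m\<close> by auto
    have "\<bar>h x - h z\<bar> < \<epsilon>" if "x - z \<in> U" for x z
    proof -
      have "h x - h z = (\<integral>y. \<phi> y * \<phi> (y + x) - \<phi> y * \<phi> (y + z) \<partial>M) / m"
        using int2[of 0] by (simp add: h_def diff_divide_distrib)
      then have "\<bar>h x - h z\<bar> = \<bar>\<integral>y. \<phi> y * \<phi> (y + x) - \<phi> y * \<phi> (y + z) \<partial>M\<bar> / m"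
        using \<open>0 < m\<close> by simp
      also have "\<bar>\<integral>y. \<phi> y * \<phi> (y + x) - \<phi> y * \<phi> (y + z) \<partial>M\<bar>
          \<le> (\<integral>y. \<bar>\<phi> (y + x) - \<phi> (y + z)\<bar> \<partial>M)"
      proof (rule order_trans[OF integral_abs_bound], rule integral_mono)
        show "\<bar>\<phi> y * \<phi> (y + x) - \<phi> y * \<phi> (y + z)\<bar> \<le> \<bar>\<phi> (y + x) - \<phi> (y + z)\<bar>" for y
          using \<phi>01[of y] by (simp add: abs_mult mult_left_le_one_le flip: right_diff_distrib)
      qed (use int2[of 0] integrable_translate[OF int_\<phi>] in auto)
      also have "\<dots> = (\<integral>y. \<bar>\<phi> (y + (x - z)) - \<phi> y\<bar> \<partial>M)"
      proof -
        have "(\<integral>y. \<bar>\<phi> (y + z + (x - z)) - \<phi> (y + z)\<bar> \<partial>M) = (\<integral>y. \<bar>\<phi> (y + (x - z)) - \<phi> y\<bar> \<partial>M)"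
          by (intro integral_translate[of "\<lambda>y. \<bar>\<phi> (y + (x - z)) - \<phi> y\<bar>"]) measurable
        moreover have "y + z + (x - z) = y + x" for y
          by simp
        ultimately show ?thesis
          by simp
      qed
      also have "\<dots> \<le> \<epsilon> * m / 2"
        by (rule U(3)[OF that])
      finally have "\<bar>h x - h z\<bar> \<le> \<epsilon> * m / 2 / m"
        using \<open>0 < m\<close> by (simp add: divide_right_mono)
      also have "\<dots> < \<epsilon>"
        using \<open>0 < m\<close> \<open>0 < \<epsilon>\<close> by simp
      finally show ?thesis .
    qed
    with U(1,2) show "\<exists>U. open U \<and> 0 \<in> U \<and> (\<forall>x y. x - y \<in> U \<longrightarrow> \<bar>h x - h y\<bar> < \<epsilon>)"
      by blast
  qed
  have h_nonneg: "0 \<le> h x" for x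
    unfolding h_def using \<phi>01 \<open>0 < m\<close> by (intro divide_nonneg_pos integral_nonneg) auto
  have h_out: "h x = 0" if "x \<notin> \<Omega>" for x
  proof -
    have "x \<notin> interior \<Omega>"
      using that interior_subset by auto
    then have "y \<notin> W \<or> y + x \<notin> W" for y
      using W(3)[of "y + x" y] by auto
    then have "(\<lambda>y. \<phi> y * \<phi> (y + x)) = (\<lambda>y. 0)"
      by (auto simp: \<phi>_def fun_eq_iff indicator_eq_0_iff)
    then show ?thesis
      unfolding h_def by simp
  qed
  have h_le: "h x \<le> indicator \<Omega> x" for x
    using real_positive_definite_abs_le[OF pd, of x] \<open>h 0 = 1\<close> h_out[of x]
    by (cases "x \<in> \<Omega>") auto
  have [measurable]: "h \<in> borel_measurable M"
    by (rule borel_measurable_continuous[OF cont])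
  have int_h: "integrable M h"
    by (rule Bochner_Integration.integrable_bound[OF integrable_indicator_\<Omega>])
      (use h_nonneg h_le in auto)
  have "h \<in> turan_class M \<Omega>"
    using cont pd \<open>h 0 = 1\<close> int_h h_out by (simp add: turan_class_iff)
  \<comment> \<open>With zero integral the nonnegative \<open>h\<close> would vanish almost
    everywhere, but the open set where it is nonzero contains 0 and has positive measure.\<close>
  moreover have "(\<integral>x. h x \<partial>M) \<noteq> 0"
  proof
    assume "(\<integral>x. h x \<partial>M) = 0"
    then have "AE x in M. h x = 0"
      using integral_nonneg_eq_0_iff_AE[OF int_h] h_nonneg by simp
    then have "emeasure M {x. h x \<noteq> 0} = 0"
      by (subst (asm) AE_iff_measurable[OF _ refl]) (auto simp: sets_M)
    moreover have "open {x. h x \<noteq> 0}"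
      by (intro open_Collect_neq cont continuous_intros)
    ultimately show False
      using emeasure_open_pos[of "{x. h x \<noteq> 0}"] \<open>h 0 = 1\<close> by force
  qed
  moreover have "0 \<le> (\<integral>x. h x \<partial>M)"
    using h_nonneg by simp
  ultimately show ?thesis
    by force
qed

end

section \<open>Maximizing sequences and their almost everywhere limits\<close>

context turan
begin

text \<open>The real counterpart of \<open>turan_const\<close>; nonemptiness of the class and the
  bound \<open>measure M \<Omega>\<close> make this supremum meaningful.\<close>

definition turan_sup :: real where
  "turan_sup = (SUP f\<in>turan_class M \<Omega>. \<integral>x. f x \<partial>M)"

lemma bdd_above_turan_integrals: "bdd_above ((\<lambda>f. \<integral>x. f x \<partial>M) ` turan_class M \<Omega>)"
  using turan_class_integral_le by (intro bdd_aboveI[of _ "measure M \<Omega>"]) auto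

lemma turan_class_nonempty: "turan_class M \<Omega> \<noteq> {}"
  using turan_class_positive_integral by auto

lemma integral_le_turan_sup: "f \<in> turan_class M \<Omega> \<Longrightarrow> (\<integral>x. f x \<partial>M) \<le> turan_sup"
  unfolding turan_sup_def by (rule cSUP_upper[OF _ bdd_above_turan_integrals])

lemma turan_sup_pos: "0 < turan_sup"
  using turan_class_positive_integral integral_le_turan_sup by (auto intro: less_le_trans)

lemma turan_sup_le: "turan_sup \<le> measure M \<Omega>"
  unfolding turan_sup_def by (intro cSUP_least turan_class_nonempty turan_class_integral_le)

lemma turan_const_eq:
  assumes "f \<in> turan_class M \<Omega>" "turan_sup \<le> (\<integral>x. f x \<partial>M)"
  shows "ereal (integral\<^sup>L M f) = turan_const M \<Omega>"
  unfolding turan_const_def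
proof (rule antisym)
  show "ereal (integral\<^sup>L M f) \<le> (SUP f\<in>turan_class M \<Omega>. ereal (integral\<^sup>L M f))"
    using assms(1) by (rule SUP_upper)
  show "(SUP f\<in>turan_class M \<Omega>. ereal (integral\<^sup>L M f)) \<le> ereal (integral\<^sup>L M f)"
    using assms(2) by (intro SUP_least) (auto intro: order_trans[OF integral_le_turan_sup])
qed

text \<open>As \<open>\<bar>f x\<bar> \<le> 1\<close>, the square is at most
  \<open>\<bar>f x\<bar>\<close>, which in turn is at most
  \<open>2 * indicator \<Omega> x - f x\<close> because \<open>f\<close> is nonpositive off
  \<Omega>. This gives a uniform L2 bound.\<close>

lemma turan_class_square:
  assumes f: "f \<in> turan_class M \<Omega>" and "0 \<le> (\<integral>x. f x \<partial>M)"
  shows "integrable M (\<lambda>x. (f x)\<^sup>2)" "(\<integral>x. (f x)\<^sup>2 \<partial>M) \<le> 2 * measure M \<Omega>"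
proof -
  note [measurable] = borel_measurable_integrable[OF turan_class_integrable[OF f]]
  have le_abs: "(f x)\<^sup>2 \<le> \<bar>f x\<bar>" for x
    using power_decreasing[of 1 2 "\<bar>f x\<bar>"] turan_class_abs_le[OF f, of x] by simp
  have le: "(f x)\<^sup>2 \<le> 2 * indicator \<Omega> x - f x" for x
    using le_abs[of x] turan_class_le_indicator[OF f, of x]
    by (cases "x \<in> \<Omega>") (auto simp: abs_if split: if_splits)
  show int: "integrable M (\<lambda>x. (f x)\<^sup>2)"
    by (rule Bochner_Integration.integrable_bound[OF turan_class_integrable[OF f]])
      (use le_abs in auto)
  have "(\<integral>x. (f x)\<^sup>2 \<partial>M) \<le> (\<integral>x. 2 * indicator \<Omega> x - f x \<partial>M)"
    by (intro integral_mono int Bochner_Integration.integrable_diff integrable_mult_right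
        integrable_indicator_\<Omega> turan_class_integrable[OF f] le)
  also have "\<dots> = 2 * measure M \<Omega> - (\<integral>x. f x \<partial>M)"
    using integrable_indicator_\<Omega> turan_class_integrable[OF f] by simp
  finally show "(\<integral>x. (f x)\<^sup>2 \<partial>M) \<le> 2 * measure M \<Omega>"
    using assms(2) by simp
qed

text \<open>Among nearly maximal functions, those of nearly minimal \<open>L\<^sup>2\<close> norm are close to each
  other, by convexity and the parallelogram identity.\<close>

lemma turan_maximizing_sequence_AE:
  "\<exists>f. (\<forall>k. f k \<in> turan_class M \<Omega> \<and> turan_sup - 1 / (real k + 1) \<le> (\<integral>x. f k x \<partial>M)) \<and>
     (AE x in M. convergent (\<lambda>k. f k x))"
proof -
  \<comment> \<open>The maximum with 0 makes the integrals nonnegative, as the uniform L2 bound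
    requires.\<close>
  define C where "C n = {f \<in> turan_class M \<Omega>. max 0 (turan_sup - 1 / (real n + 1)) \<le> (\<integral>x. f x \<partial>M)}"
    for n :: nat
  define Q where "Q f = (\<integral>x. (f x)\<^sup>2 \<partial>M)" for f :: "'a \<Rightarrow> real"
  have C_ne: "C n \<noteq> {}" for n
  proof -
    have "max 0 (turan_sup - 1 / (real n + 1)) < turan_sup"
      using turan_sup_pos by simp
    then show ?thesis
      using less_cSUP_iff[OF turan_class_nonempty bdd_above_turan_integrals]
      unfolding turan_sup_def C_def by (auto intro: less_imp_le)
  qed
  have C_mono: "C n \<subseteq> C m" if "m \<le> n" for m n
  proof -
    have "1 / (real n + 1) \<le> 1 / (real m + 1)"
      using that by (intro divide_left_mono) auto
    then show ?thesis
      unfolding C_def by auto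
  qed
  have C_mid: "(\<lambda>x. (f x + g x) / 2) \<in> C n" if "f \<in> C n" "g \<in> C n" for f g n
  proof -
    have "(\<integral>x. (f x + g x) / 2 \<partial>M) = ((\<integral>x. f x \<partial>M) + (\<integral>x. g x \<partial>M)) / 2"
      using that turan_class_integrable by (simp add: C_def)
    then show ?thesis
      using that turan_class_midpoint[of f g] by (auto simp: C_def)
  qed
  have Q_bounds: "0 \<le> Q f" "Q f \<le> 2 * measure M \<Omega>" "integrable M (\<lambda>x. (f x)\<^sup>2)"
    if "f \<in> C n" for f n
    using that turan_class_square[of f] by (auto simp: C_def Q_def)
  have "\<exists>s. (\<forall>n\<in>UNIV. \<forall>\<epsilon>>0. \<exists>f\<in>C n. Q f < s + \<epsilon>) \<and> (\<forall>\<epsilon>>0. \<exists>n\<in>UNIV. \<forall>f\<in>C n. s - \<epsilon> < Q f)"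
    using C_ne Q_bounds by (intro SUP_INF_approx[of UNIV C Q "2 * measure M \<Omega>"]) simp_all
  then obtain s where s: "\<And>n \<epsilon>. 0 < \<epsilon> \<Longrightarrow> \<exists>f\<in>C n. Q f < s + \<epsilon>"
    "\<And>\<epsilon>. 0 < \<epsilon> \<Longrightarrow> \<exists>n. \<forall>f\<in>C n. s - \<epsilon> < Q f"
    by auto
  have "\<forall>k. \<exists>n. \<forall>f\<in>C n. s - (1/4)^k < Q f"
    using s(2) by simp
  then obtain i where i: "\<And>k f. f \<in> C (i k) \<Longrightarrow> s - (1/4)^k < Q f"
    by metis
  \<comment> \<open>Index \<open>k\<close> secures the lower bound on the integral, index
    \<open>i k\<close> the lower bound on \<open>Q\<close>.\<close>
  have "\<forall>k. \<exists>f\<in>C (max k (i k)). Q f < s + (1/4)^k"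
    using s(1) by simp
  then obtain f where f: "\<And>k. f k \<in> C (max k (i k))" "\<And>k. Q (f k) < s + (1/4)^k"
    by metis
  have f_C: "f k \<in> C k" "f k \<in> C (i k)" for k
    using f(1)[of k] C_mono[of k "max k (i k)"] C_mono[of "i k" "max k (i k)"] by auto
  have f_class: "f k \<in> turan_class M \<Omega>" for k
    using f_C(1)[of k] by (simp add: C_def)
  note int = turan_class_integrable[OF f_class]
  note [measurable] = borel_measurable_integrable[OF int]
  let ?mid = "\<lambda>k x. (f (Suc k) x + f k x) / 2"
  have mid: "s - (1/4)^k < Q (?mid k) \<and> integrable M (\<lambda>x. (?mid k x)\<^sup>2)" for k
  proof -
    \<comment> \<open>The smaller index gives a set containing both functions, hence their midpoint,
      and it is still an index with a known lower bound for \<open>Q\<close>.\<close>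
    define m where "m = min (i k) (i (Suc k))"
    have mid_C: "?mid k \<in> C m"
      using C_mono[of m "i k"] C_mono[of m "i (Suc k)"] f_C(2)
      by (intro C_mid) (auto simp: m_def)
    have "m = i k \<or> m = i (Suc k)"
      by (simp add: m_def min_def)
    then have "s - (1/4)^k < Q (?mid k)"
    proof
      assume "m = i (Suc k)"
      then have "s - (1/4)^Suc k < Q (?mid k)"
        using i mid_C by blast
      moreover have "(1/4)^Suc k \<le> (1/4::real)^k"
        by simp
      ultimately show ?thesis
        by linarith
    qed (use i mid_C in blast)
    then show ?thesis
      using Q_bounds(3)[OF mid_C] by simp
  qed
  have para: "(f (Suc k) x - f k x)\<^sup>2 = 2 * (f (Suc k) x)\<^sup>2 + 2 * (f k x)\<^sup>2 - 4 * (?mid k x)\<^sup>2" for k x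
    by (simp add: power2_eq_square field_simps)
  have int_sq: "integrable M (\<lambda>x. (f k x)\<^sup>2)" for k
    by (rule Q_bounds(3)[OF f_C(1)])
  have int_diff: "integrable M (\<lambda>x. (f (Suc k) x - f k x)\<^sup>2)" for k
    unfolding para using int_sq mid[of k]
    by (intro Bochner_Integration.integrable_add Bochner_Integration.integrable_diff
        integrable_mult_right) auto
  \<comment> \<open>The parallelogram identity bounds this by
    \<open>4 * (s + (1/4)^k) - 4 * (s - (1/4)^k)\<close>, whence the 8.\<close>
  have "(\<integral>x. (f (Suc k) x - f k x)\<^sup>2 \<partial>M) \<le> 8 * (1/4)^k" for k
  proof -
    have "(\<integral>x. (f (Suc k) x - f k x)\<^sup>2 \<partial>M) = 2 * Q (f (Suc k)) + 2 * Q (f k) - 4 * Q (?mid k)"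
      unfolding para Q_def using int_sq conjunct2[OF mid[of k]]
      by (subst Bochner_Integration.integral_diff, simp, simp,
          subst Bochner_Integration.integral_add) auto
    moreover have "Q (f (Suc k)) < s + (1/4)^k"
    proof -
      have "(1/4)^Suc k \<le> (1/4::real)^k"
        by simp
      then show ?thesis
        using f(2)[of "Suc k"] by linarith
    qed
    ultimately show ?thesis
      using f(2)[of k] mid[of k] by linarith
  qed
  then have "AE x in M. convergent (\<lambda>k. f k x)"
    by (intro AE_convergent_L2[where B = 8] int_diff) auto
  moreover have "turan_sup - 1 / (real k + 1) \<le> (\<integral>x. f k x \<partial>M)" for k
    using f_C(1)[of k] by (simp add: C_def)
  ultimately show ?thesis
    using f_class by blast
qed

text \<open>No common integrable minorant is at hand, but only a lower bound on the integral of the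
  limit is wanted, and Fatou's lemma for \<open>indicator \<Omega> x - f k x\<close> gives
  it.\<close>

lemma turan_maximizing_limit:
  "\<exists>f F. (\<forall>k. f k \<in> turan_class M \<Omega>) \<and> integrable M F \<and> turan_sup \<le> (\<integral>x. F x \<partial>M) \<and>
     (AE x in M. (\<lambda>k. f k x) \<longlonglongrightarrow> F x)"
proof -
  obtain f where f: "\<And>k. f k \<in> turan_class M \<Omega>"
    "\<And>k. turan_sup - 1 / (real k + 1) \<le> (\<integral>x. f k x \<partial>M)"
    "AE x in M. convergent (\<lambda>k. f k x)"
    using turan_maximizing_sequence_AE by auto
  note int = turan_class_integrable[OF f(1)]
  note [measurable] = borel_measurable_integrable[OF int]
  \<comment> \<open>Where the sequence diverges, \<open>lim\<close> is unspecified; this concerns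
    only a null set.\<close>
  define F where "F x = lim (\<lambda>k. f k x)" for x
  have [measurable]: "F \<in> borel_measurable M"
    unfolding F_def by measurable
  have lim: "AE x in M. (\<lambda>k. f k x) \<longlonglongrightarrow> F x"
    using f(3) by eventually_elim (simp add: F_def convergent_LIMSEQ_iff)
  let ?u = "\<lambda>k x. indicator \<Omega> x - f k x" and ?U = "\<lambda>x. indicator \<Omega> x - F x"
  have u_nonneg: "0 \<le> ?u k x" for k x
    using turan_class_le_indicator[OF f(1)] by simp
  have U_lim: "AE x in M. (\<lambda>k. ?u k x) \<longlonglongrightarrow> ?U x"
    using lim by eventually_elim (intro tendsto_intros)
  then have U_nonneg: "AE x in M. 0 \<le> ?U x"
    by eventually_elim (rule LIMSEQ_le_const, use u_nonneg in auto)
  have int_u: "integrable M (?u k)" for k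
    using integrable_indicator_\<Omega> int by (rule Bochner_Integration.integrable_diff)
  have "(\<integral>\<^sup>+x. ennreal (?U x) \<partial>M) = (\<integral>\<^sup>+x. liminf (\<lambda>k. ennreal (?u k x)) \<partial>M)"
  proof (rule nn_integral_cong_AE)
    show "AE x in M. ennreal (?U x) = liminf (\<lambda>k. ennreal (?u k x))"
      using U_lim by eventually_elim (metis lim_imp_Liminf sequentially_bot tendsto_ennrealI)
  qed
  also have "\<dots> \<le> liminf (\<lambda>k. \<integral>\<^sup>+x. ennreal (?u k x) \<partial>M)"
    by (rule nn_integral_liminf) measurable
  also have "\<dots> \<le> liminf (\<lambda>k. ennreal (measure M \<Omega> - turan_sup + 1 / (real k + 1)))"
  proof (intro Liminf_mono always_eventually allI)
    fix k
    have "(\<integral>\<^sup>+x. ennreal (?u k x) \<partial>M) = ennreal (\<integral>x. ?u k x \<partial>M)"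
      using int_u u_nonneg by (intro nn_integral_eq_integral) auto
    also have "(\<integral>x. ?u k x \<partial>M) = measure M \<Omega> - (\<integral>x. f k x \<partial>M)"
      using integrable_indicator_\<Omega> int[of k] by simp
    also have "\<dots> \<le> measure M \<Omega> - turan_sup + 1 / (real k + 1)"
      using f(2)[of k] by simp
    finally show "(\<integral>\<^sup>+x. ennreal (?u k x) \<partial>M) \<le> ennreal (measure M \<Omega> - turan_sup + 1 / (real k + 1))"
      by (simp add: ennreal_leI)
  qed
  also have "\<dots> = ennreal (measure M \<Omega> - turan_sup)"
  proof (rule lim_imp_Liminf)
    have "(\<lambda>k. measure M \<Omega> - turan_sup + 1 / (real k + 1)) \<longlonglongrightarrow> measure M \<Omega> - turan_sup + 0"
      using LIMSEQ_inverse_real_of_nat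
      by (intro tendsto_add tendsto_const) (simp add: inverse_eq_divide add.commute)
    then show "(\<lambda>k. ennreal (measure M \<Omega> - turan_sup + 1 / (real k + 1)))
        \<longlonglongrightarrow> ennreal (measure M \<Omega> - turan_sup)"
      by (intro tendsto_ennrealI) simp
  qed simp
  finally have nn: "(\<integral>\<^sup>+x. ennreal (?U x) \<partial>M) \<le> ennreal (measure M \<Omega> - turan_sup)" .
  have int_U: "integrable M ?U"
    using nn U_nonneg by (intro integrableI_nonneg) (auto intro: le_less_trans)
  have "integrable M (\<lambda>x. indicator \<Omega> x - ?U x)"
    using integrable_indicator_\<Omega> int_U by (rule Bochner_Integration.integrable_diff)
  then have int_F: "integrable M F"
    by simp
  have "ennreal (\<integral>x. ?U x \<partial>M) \<le> ennreal (measure M \<Omega> - turan_sup)"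
    using nn nn_integral_eq_integral[OF int_U U_nonneg] by simp
  then have "(\<integral>x. ?U x \<partial>M) \<le> measure M \<Omega> - turan_sup"
    using turan_sup_le by (subst (asm) ennreal_le_iff) auto
  then have "turan_sup \<le> (\<integral>x. F x \<partial>M)"
    using integrable_indicator_\<Omega> int_F by simp
  then show ?thesis
    using f(1) int_F lim by blast
qed

end

section \<open>The continuous part of a positive definite function\<close>

lemma open_add_neighbourhood:
  fixes V :: "'a::topological_ab_group_add set"
  assumes "open V" "0 \<in> V"
  obtains U where "open U" "0 \<in> U" "\<And>x y. x \<in> U \<Longrightarrow> y \<in> U \<Longrightarrow> x + y \<in> V"
proof -
  obtain U where U: "open U" "0 \<in> U" "\<And>x y. x \<in> U \<Longrightarrow> y \<in> U \<Longrightarrow> x - y \<in> V"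
    using open_diff_neighbourhood[OF assms] by metis
  have "open (uminus -` U)"
    by (rule open_vimage[OF U(1)]) (intro continuous_intros)
  then have "open (U \<inter> uminus -` U)"
    using U(1) by (rule open_Int[rotated])
  moreover have "x + y \<in> V" if "x \<in> U \<inter> uminus -` U" "y \<in> U \<inter> uminus -` U" for x y
    using U(3)[of x "- y"] that by simp
  ultimately show thesis
    using that[of "U \<inter> uminus -` U"] U(2) by simp
qed

lemma list_average_le:
  assumes "xs \<noteq> []" "\<And>x. f x \<le> B"
  shows "list_average xs f z \<le> B"
proof -
  have "(\<Sum>k<length xs. \<Sum>l<length xs. f (z + xs ! k - xs ! l)) \<le> (\<Sum>k<length xs. \<Sum>l<length xs. B)"
    by (intro sum_mono assms(2))
  also have "\<dots> = B * (real (length xs))\<^sup>2"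
    by (simp add: power2_eq_square)
  finally show ?thesis
    using assms(1) by (simp add: list_average_conv_sum pos_divide_le_eq)
qed

lemma list_average_diff:
  assumes "xs \<noteq> []"
  shows "\<bar>list_average xs f z - f z\<bar>
    \<le> (\<Sum>k<length xs. \<Sum>l<length xs. \<bar>f (z + (xs ! k - xs ! l)) - f z\<bar>) / (real (length xs))\<^sup>2"
proof -
  let ?m = "length xs"
  have "f z = (\<Sum>k<?m. \<Sum>l<?m. f z) / (real ?m)\<^sup>2"
    using assms by (simp add: power2_eq_square)
  then have "list_average xs f z - f z = (\<Sum>k<?m. \<Sum>l<?m. f (z + (xs ! k - xs ! l)) - f z) / (real ?m)\<^sup>2"
    by (simp only: list_average_conv_sum sum_subtractf diff_divide_distrib add_diff_eq)
  also have "\<bar>\<dots>\<bar> \<le> (\<Sum>k<?m. \<Sum>l<?m. \<bar>f (z + (xs ! k - xs ! l)) - f z\<bar>) / (real ?m)\<^sup>2"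
    unfolding abs_divide abs_power2
    by (intro divide_right_mono order_trans[OF sum_abs] sum_mono) auto
  finally show ?thesis .
qed

context haar
begin

lemma integrable_list_average:
  assumes "integrable M f"
  shows "integrable M (list_average xs f)"
proof -
  have "integrable M (\<lambda>z. (\<Sum>k<length xs. \<Sum>l<length xs. f (z + (xs ! k - xs ! l))) / (real (length xs))\<^sup>2)"
    by (intro integrable_divide Bochner_Integration.integrable_sum integrable_translate assms)
  then show ?thesis
    by (simp add: list_average_conv_sum[abs_def] add_diff_eq)
qed

text \<open>By the triangle inequality, the L1 error of the average is at most the mean of the
  errors of its translations.\<close>

lemma L1_list_average_le:
  assumes f: "integrable M f" and "xs \<noteq> []"
    and le: "\<And>a b. a \<in> set xs \<Longrightarrow> b \<in> set xs \<Longrightarrow> (\<integral>x. \<bar>f (x + (a - b)) - f x\<bar> \<partial>M) \<le> \<delta>"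
  shows "(\<integral>z. \<bar>list_average xs f z - f z\<bar> \<partial>M) \<le> \<delta>"
proof -
  let ?m = "length xs"
  have int: "integrable M (\<lambda>z. \<bar>f (z + u) - f z\<bar>)" for u
    by (intro integrable_abs Bochner_Integration.integrable_diff integrable_translate f)
  have "(\<integral>z. \<bar>list_average xs f z - f z\<bar> \<partial>M)
      \<le> (\<integral>z. (\<Sum>k<?m. \<Sum>l<?m. \<bar>f (z + (xs ! k - xs ! l)) - f z\<bar>) / (real ?m)\<^sup>2 \<partial>M)"
    by (intro integral_mono integrable_abs Bochner_Integration.integrable_diff integrable_list_average f
        integrable_divide Bochner_Integration.integrable_sum int list_average_diff \<open>xs \<noteq> []\<close>)
  also have "\<dots> = (\<Sum>k<?m. \<Sum>l<?m. (\<integral>z. \<bar>f (z + (xs ! k - xs ! l)) - f z\<bar> \<partial>M)) / (real ?m)\<^sup>2"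
    by (simp add: int Bochner_Integration.integral_sum Bochner_Integration.integrable_sum)
  also have "\<dots> \<le> (\<Sum>k<?m. \<Sum>l<?m. \<delta>) / (real ?m)\<^sup>2"
    by (intro divide_right_mono sum_mono le nth_mem) auto
  also have "\<dots> = \<delta>"
    using \<open>xs \<noteq> []\<close> by (simp add: power2_eq_square)
  finally show ?thesis .
qed

text \<open>A list average samples finitely many translates, and translates of null sets are
  null.\<close>

lemma AE_eq_list_average:
  assumes "AE x in M. p x = f x"
  shows "AE z in M. list_average xs p z = list_average xs f z"
proof -
  have "AE z in M. \<forall>k\<in>{..<length xs}. \<forall>l\<in>{..<length xs}. p (z + (xs ! k - xs ! l)) = f (z + (xs ! k - xs ! l))"
    using AE_translate[OF assms] by (intro AE_ball_countable[THEN iffD2] ballI) auto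
  then show ?thesis
    by eventually_elim (simp add: list_average_conv_sum add_diff_eq)
qed

text \<open>A positive definite \<open>p\<close> splits into a continuous part and a part that averages out near 0.
  Averaging over lists of points near 0 with nearly minimal \<open>list_average xs p 0\<close> isolates the
  continuous part: by minimality doubling the list barely changes this value, which bounds the
  oscillation at 0, and \<open>L\<^sup>1\<close>-continuity of translation shows that nothing is lost almost
  everywhere.\<close>

lemma positive_definite_AE_eq_continuous:
  assumes p: "real_positive_definite p" and F: "integrable M F" and eq: "AE x in M. p x = F x"
  shows "\<exists>g. continuous_on UNIV g \<and> real_positive_definite g \<and> g 0 \<le> p 0 \<and> (AE x in M. g x = F x)"
proof -
  define I where "I = {U::'a set. open U \<and> 0 \<in> U}"
  define A where "A U = {xs. xs \<noteq> [] \<and> set xs \<subseteq> U}" for U :: "'a set"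
  define Q where "Q xs = list_average xs p 0" for xs
  have pd: "real_positive_definite (list_average xs p)" for xs
    by (rule real_positive_definite_list_average[OF p])
  have le_p0: "list_average xs p z \<le> p 0" if "xs \<noteq> []" for xs z
    using real_positive_definite_abs_le[OF p] by (intro list_average_le that) (simp add: abs_le_iff)
  \<comment> \<open>Here \<open>s\<close> is the limit of the infima of the averages at 0 as the
    neighbourhood shrinks.\<close>
  have "\<exists>s. (\<forall>U\<in>I. \<forall>\<epsilon>>0. \<exists>xs\<in>A U. Q xs < s + \<epsilon>) \<and> (\<forall>\<epsilon>>0. \<exists>U\<in>I. \<forall>xs\<in>A U. s - \<epsilon> < Q xs)"
  proof (rule SUP_INF_approx)
    show "I \<noteq> {}"
      unfolding I_def by (auto intro: exI[of _ UNIV])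
    show "A U \<noteq> {}" if "U \<in> I" for U
    proof -
      have "[0] \<in> A U"
        using that by (simp add: A_def I_def)
      then show ?thesis by auto
    qed
    show "0 \<le> Q xs" for xs
      using real_positive_definite_abs_le[OF pd, of xs 0] by (simp add: Q_def)
    show "Q xs \<le> p 0" if "xs \<in> A U" for xs U
      using that le_p0 by (simp add: A_def Q_def)
  qed
  then obtain s where s: "\<And>U \<epsilon>. U \<in> I \<Longrightarrow> 0 < \<epsilon> \<Longrightarrow> \<exists>xs\<in>A U. Q xs < s + \<epsilon>"
    "\<And>\<epsilon>. 0 < \<epsilon> \<Longrightarrow> \<exists>U\<in>I. \<forall>xs\<in>A U. s - \<epsilon> < Q xs"
    by metis
  let ?\<epsilon> = "\<lambda>n::nat. 1 / (real n + 1)"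
  \<comment> \<open>With \<open>T + T\<close> inside \<open>W\<close>, doubled lists remain where
    all averages exceed \<open>s - ?\<epsilon> n\<close>; differences of points of \<open>T\<close>
    translate \<open>F\<close> little in L1.\<close>
  define P where "P n T W \<longleftrightarrow> T \<in> I \<and> (\<forall>x\<in>T. \<forall>y\<in>T. x + y \<in> W) \<and> (\<forall>xs\<in>A W. s - ?\<epsilon> n < Q xs) \<and>
      (\<forall>x\<in>T. \<forall>y\<in>T. (\<integral>z. \<bar>F (z + (x - y)) - F z\<bar> \<partial>M) \<le> ?\<epsilon> n)" for n T W
  have "\<exists>T W. P n T W" for n
  proof -
    obtain W where W: "W \<in> I" "\<forall>xs\<in>A W. s - ?\<epsilon> n < Q xs"
      using s(2)[of "?\<epsilon> n"] by auto
    have "open W" "0 \<in> W"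
      using W(1) by (simp_all add: I_def)
    then obtain T1 where T1: "open T1" "0 \<in> T1" "\<And>x y. x \<in> T1 \<Longrightarrow> y \<in> T1 \<Longrightarrow> x + y \<in> W"
      using open_add_neighbourhood by metis
    have "0 < ?\<epsilon> n"
      by simp
    obtain V where V: "open V" "0 \<in> V" "\<And>u. u \<in> V \<Longrightarrow> (\<integral>z. \<bar>F (z + u) - F z\<bar> \<partial>M) \<le> ?\<epsilon> n"
      using L1_translation_continuous[OF F \<open>0 < ?\<epsilon> n\<close>] by metis
    obtain T2 where T2: "open T2" "0 \<in> T2" "\<And>x y. x \<in> T2 \<Longrightarrow> y \<in> T2 \<Longrightarrow> x - y \<in> V"
      using open_diff_neighbourhood[OF V(1,2)] by metis
    show ?thesis
      unfolding P_def
    proof (rule exI[of _ "T1 \<inter> T2"], rule exI[of _ W], intro conjI ballI)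
      show "T1 \<inter> T2 \<in> I"
        using T1 T2 by (simp add: I_def open_Int)
    qed (use T1(3) W(2) V(3) T2(3) in simp_all)
  qed
  then obtain T W where "\<And>n. P n (T n) (W n)"
    by metis
  then have T: "T n \<in> I" and TW: "x \<in> T n \<Longrightarrow> y \<in> T n \<Longrightarrow> x + y \<in> W n"
    and W: "xs \<in> A (W n) \<Longrightarrow> s - ?\<epsilon> n < Q xs"
    and TF: "x \<in> T n \<Longrightarrow> y \<in> T n \<Longrightarrow> (\<integral>z. \<bar>F (z + (x - y)) - F z\<bar> \<partial>M) \<le> ?\<epsilon> n"
    for n x y xs
    by (simp_all add: P_def)
  \<comment> \<open>Intersecting makes the conditions cumulative: points of \<open>U n\<close>
    satisfy those of every stage \<open>m \<le> n\<close>.\<close>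
  define U where "U n = (\<Inter>m\<in>{..n}. T m)" for n
  have U: "U n \<in> I" for n
    using T by (auto simp: U_def I_def intro!: open_INT)
  have U_sub: "U n \<subseteq> T m" if "m \<le> n" for m n
    using that by (auto simp: U_def)
  have "\<forall>n. \<exists>xs\<in>A (U n). Q xs < s + ?\<epsilon> n"
    using s(1)[OF U] by simp
  then obtain xs where xs: "\<And>n. xs n \<in> A (U n)" "\<And>n. Q (xs n) < s + ?\<epsilon> n"
    by metis
  have xs_ne: "xs n \<noteq> []" and xs_sub: "set (xs n) \<subseteq> U n" for n
    using xs(1)[of n] by (simp_all add: A_def)
  define g where "g n = list_average (xs n) p" for n
  \<comment> \<open>Near minimality gives \<open>2 * g n 0 < 2 * s + 2 * ?\<epsilon> m\<close>, and
    the doubled list gives \<open>g n 0 + g n z > 2 * s - 2 * ?\<epsilon> m\<close>; their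
    difference leaves four error terms.\<close>
  have osc: "g n 0 - g n z \<le> 4 / (real m + 1)" if "m \<le> n" "z \<in> U m" for m n z
  proof -
    have "set (xs n @ map (\<lambda>a. z + a) (xs n)) \<subseteq> W m"
    proof -
      have "a \<in> W m \<and> z + a \<in> W m" if "a \<in> set (xs n)" for a
      proof -
        have "a \<in> T m" "0 \<in> T m" "z \<in> T m"
          using that xs_sub[of n] U_sub[OF \<open>m \<le> n\<close>] T[of m] U_sub[of m m] \<open>z \<in> U m\<close>
          by (auto simp: I_def)
        then show ?thesis
          using TW[of a m 0] TW[of z m a] by simp
      qed
      then show ?thesis by auto
    qed
    then have "s - ?\<epsilon> m < Q (xs n @ map (\<lambda>a. z + a) (xs n))"
      using xs_ne[of n] by (intro W) (simp add: A_def)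
    moreover have "2 * Q (xs n @ map (\<lambda>a. z + a) (xs n)) = g n 0 + g n z"
      unfolding Q_def g_def by (rule list_average_append_translate[OF p])
    moreover have "g n 0 < s + ?\<epsilon> n"
      using xs(2)[of n] by (simp add: Q_def g_def)
    moreover have "?\<epsilon> n \<le> ?\<epsilon> m"
      using \<open>m \<le> n\<close> by (intro divide_left_mono) auto
    moreover have "4 / (real m + 1) = 4 * ?\<epsilon> m"
      by simp
    ultimately show ?thesis
      by linarith
  qed
  \<comment> \<open>The L1 estimates are made for averages of the integrable \<open>F\<close>, since
    \<open>p\<close> is only known to agree with it almost everywhere.\<close>
  define G where "G n = list_average (xs n) F" for n
  have int_G: "integrable M (G n)" for n
    unfolding G_def by (rule integrable_list_average[OF F])
  have L1: "(\<integral>z. \<bar>G n z - F z\<bar> \<partial>M) \<le> ?\<epsilon> n" for n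
    unfolding G_def using xs_sub[of n] U_sub[of n n] xs_ne
    by (intro L1_list_average_le F TF) auto
  have "(\<lambda>n. \<integral>z. norm (G n z - F z) \<partial>M) \<longlonglongrightarrow> 0"
  proof (rule tendsto_sandwich[of "\<lambda>_. 0"])
    show "?\<epsilon> \<longlonglongrightarrow> 0"
      using LIMSEQ_inverse_real_of_nat by (simp add: inverse_eq_divide add.commute)
  qed (use L1 in auto)
  then obtain r :: "nat \<Rightarrow> nat" where r: "strict_mono r" "AE x in M. (\<lambda>n. G (r n) x - F x) \<longlonglongrightarrow> 0"
    using tendsto_L1_AE_subseq[of M "\<lambda>n x. G n x - F x"] int_G F by auto
  have "AE x in M. \<forall>n. g n x = G n x"
    unfolding g_def G_def AE_all_countable using AE_eq_list_average[OF eq] by blast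
  with r(2) have g_lim: "AE x in M. (\<lambda>n. g (r n) x) \<longlonglongrightarrow> F x"
    by eventually_elim (simp add: LIM_zero_iff)
  have "\<bar>g (r n) x\<bar> \<le> p 0" for n x
    using real_positive_definite_abs_le[OF pd] le_p0[OF xs_ne] unfolding g_def by (rule order_trans)
  \<comment> \<open>The subsequence converges only almost everywhere; the filter gives a limit at
    every point. As \<open>L\<close> refines \<open>sequentially\<close>, the two limits agree
    almost everywhere.\<close>
  then obtain h L where L: "L \<noteq> bot" "L \<le> sequentially" and h: "\<And>x. ((\<lambda>n. g (r n) x) \<longlongrightarrow> h x) L"
    using bounded_functions_cluster_point[of "\<lambda>n. g (r n)" "p 0"] by blast
  have pd_h: "real_positive_definite h"
    by (rule real_positive_definite_tendsto[OF L(1) _ h]) (simp add: g_def pd)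
  have "AE x in M. h x = F x"
    using g_lim by eventually_elim (metis L h tendsto_mono tendsto_unique)
  moreover have "h 0 \<le> p 0"
    using le_p0[OF xs_ne] by (intro tendsto_upperbound[OF h _ L(1)]) (simp add: g_def)
  moreover have osc_h: "h 0 - h z \<le> 4 / (real m + 1)" if "z \<in> U m" for m z
  proof (rule tendsto_upperbound[OF tendsto_diff[OF h h] _ L(1)])
    have "\<forall>\<^sub>F n in sequentially. g (r n) 0 - g (r n) z \<le> 4 / (real m + 1)"
      using eventually_ge_at_top[of m]
    proof eventually_elim
      case (elim n)
      then show ?case
        using osc[OF _ that, of "r n"] seq_suble[OF r(1), of n] by simp
    qed
    then show "\<forall>\<^sub>F n in L. g (r n) 0 - g (r n) z \<le> 4 / (real m + 1)"
      using L(2) by (rule filter_leD[rotated])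
  qed
  have "continuous_on UNIV h"
  proof (rule continuous_on_uniform_translate)
    fix \<epsilon> :: real assume "0 < \<epsilon>"
    \<comment> \<open>Chosen so that Krein's inequality and \<open>osc_h\<close> bound the squared
      difference by less than \<open>\<epsilon>\<^sup>2\<close>.\<close>
    obtain m :: nat where m: "8 * h 0 / \<epsilon>\<^sup>2 < real m"
      using reals_Archimedean2 by blast
    have "0 \<le> h 0"
      using real_positive_definite_abs_le[OF pd_h, of 0] by simp
    have "\<bar>h x - h y\<bar> < \<epsilon>" if "x - y \<in> U m" for x y
    proof -
      have "(h x - h y)\<^sup>2 \<le> 2 * h 0 * (h 0 - h (x - y))"
        by (rule real_positive_definite_diff_square_le[OF pd_h])
      also have "\<dots> \<le> 2 * h 0 * (4 / (real m + 1))"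
        using \<open>0 \<le> h 0\<close> by (intro mult_left_mono osc_h that) simp
      also have "\<dots> < \<epsilon>\<^sup>2"
        using m \<open>0 < \<epsilon>\<close> by (simp add: field_simps add_strict_increasing)
      finally show ?thesis
        using abs_le_square_iff[of \<epsilon> "h x - h y"] \<open>0 < \<epsilon>\<close> by linarith
    qed
    then show "\<exists>U. open U \<and> 0 \<in> U \<and> (\<forall>x y. x - y \<in> U \<longrightarrow> \<bar>h x - h y\<bar> < \<epsilon>)"
      using U[of m] unfolding I_def by blast
  qed
  ultimately show ?thesis
    using pd_h by blast
qed

end

section \<open>Existence of the extremal function\<close>

context turan
begin

lemma turan_extremal_exists: "\<exists>f\<in>turan_class M \<Omega>. turan_sup \<le> (\<integral>x. f x \<partial>M)"
proof -
  obtain fs F where fs: "\<And>k. fs k \<in> turan_class M \<Omega>" and F: "integrable M F"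
    "turan_sup \<le> (\<integral>x. F x \<partial>M)" and lim: "AE x in M. (\<lambda>k. fs k x) \<longlonglongrightarrow> F x"
    using turan_maximizing_limit by auto
  obtain p L where L: "L \<noteq> bot" "L \<le> sequentially" and p: "\<And>x. ((\<lambda>k. fs k x) \<longlongrightarrow> p x) L"
    using bounded_functions_cluster_point[of fs 1, OF turan_class_abs_le[OF fs]] by metis
  have "real_positive_definite p"
    by (rule real_positive_definite_tendsto[OF L(1) _ p]) (use fs in \<open>simp add: turan_class_iff\<close>)
  moreover have "AE x in M. p x = F x"
    using lim by eventually_elim (metis L p tendsto_mono tendsto_unique)
  \<comment> \<open>Almost everywhere equality may say nothing about the single point 0; the
    normalisation survives through the pointwise limit.\<close>
  moreover have "p 0 = 1"
    using p[of 0] fs L(1) by (simp add: turan_class_iff tendsto_const_iff)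
  ultimately obtain g where g: "continuous_on UNIV g" "real_positive_definite g" "g 0 \<le> 1"
    "AE x in M. g x = F x"
    using positive_definite_AE_eq_continuous[OF _ F(1)] by metis
  have [measurable]: "g \<in> borel_measurable M"
    by (rule borel_measurable_continuous[OF g(1)])
  have F_meas: "F \<in> borel_measurable M"
    using F(1) by simp
  have int_g: "integrable M g"
    using F(1) integrable_cong_AE[OF _ F_meas g(4)] by simp
  have sup_le: "turan_sup \<le> (\<integral>x. g x \<partial>M)"
    using F(2) integral_cong_AE[OF _ F_meas g(4)] by simp
  have g_out: "g x \<le> 0" if "x \<notin> \<Omega>" for x
  proof (rule ccontr)
    assume "\<not> g x \<le> 0"
    \<comment> \<open>Almost everywhere off \<Omega>, \<open>g\<close> equals \<open>F\<close>, a
      limit of nonpositive values. So this open set is null, and nonempty open sets have positive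
      measure.\<close>
    let ?N = "{x. 0 < g x} \<inter> - \<Omega>"
    have "open ?N"
      using closed_\<Omega> by (intro open_Int open_Collect_less g(1) continuous_intros) auto
    have "AE y in M. y \<notin> ?N"
      using lim g(4)
    proof eventually_elim
      case (elim y)
      show ?case
      proof
        assume y: "y \<in> ?N"
        then have "F y \<le> 0"
          using elim(1) fs by (intro LIMSEQ_le_const2[OF elim(1)]) (auto simp: turan_class_iff)
        with y elim(2) show False by simp
      qed
    qed
    then have "emeasure M ?N = 0"
      using \<open>open ?N\<close> by (subst (asm) AE_iff_measurable[of ?N]) (auto simp: sets_M)
    moreover have "x \<in> ?N"
      using that \<open>\<not> g x \<le> 0\<close> by simp
    ultimately show False
      using emeasure_open_pos[OF \<open>open ?N\<close>] by force
  qed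
  have "0 < g 0"
  proof (rule ccontr)
    assume "\<not> 0 < g 0"
    then have "g x = 0" for x
      using real_positive_definite_abs_le[OF g(2), of x] by simp
    then show False
      using sup_le turan_sup_pos by simp
  qed
  let ?f = "\<lambda>x. g x / g 0"
  have "?f \<in> turan_class M \<Omega>"
    using g(1) \<open>0 < g 0\<close> int_g g_out real_positive_definite_divide[OF g(2)]
    by (auto simp: turan_class_iff divide_le_0_iff intro!: continuous_intros)
  \<comment> \<open>Since \<open>0 < g 0\<close> and \<open>g 0 \<le> 1\<close>, division by
    \<open>g 0\<close> cannot lower a positive integral.\<close>
  moreover have "turan_sup \<le> (\<integral>x. ?f x \<partial>M)"
  proof -
    have "turan_sup * g 0 \<le> turan_sup"
      using g(3) turan_sup_pos by simp
    also note sup_le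
    finally show ?thesis
      using \<open>0 < g 0\<close> by (simp add: pos_le_divide_eq)
  qed
  ultimately show ?thesis
    by blast
qed

end

theorem theorem8:
  fixes M :: "'a::{topological_ab_group_add, t2_space} measure"
    and \<Omega> :: "'a set"
  assumes "locally_compact_space (euclidean :: 'a topology)"
    and "sigma_compact_type TYPE('a)"
    and "haar_measure M"
    and "closed \<Omega>" and "0 \<in> interior \<Omega>"
    and "emeasure M \<Omega> < \<infinity>"
  shows "\<exists>f \<in> turan_class M \<Omega>.
           ereal (integral\<^sup>L M f) = turan_const M \<Omega> \<and>
           (\<exists>fs :: nat \<Rightarrow> 'a \<Rightarrow> real.
              (\<forall>n. fs n \<in> turan_class M \<Omega>) \<and>
              (\<lambda>n. ereal (integral\<^sup>L M (fs n))) \<longlonglongrightarrow> turan_const M \<Omega> \<and>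
              (\<forall>K. compact K \<longrightarrow> uniform_limit K fs f sequentially))"
proof -
  interpret turan M \<Omega>
    using assms(3-6) by unfold_locales
  obtain f where f: "f \<in> turan_class M \<Omega>" "turan_sup \<le> (\<integral>x. f x \<partial>M)"
    using turan_extremal_exists by blast
  have eq: "ereal (integral\<^sup>L M f) = turan_const M \<Omega>"
    by (rule turan_const_eq[OF f])
  show ?thesis
  proof (intro bexI[OF _ f(1)] conjI exI[of _ "\<lambda>_. f"] allI impI)
    show "(\<lambda>n. ereal (integral\<^sup>L M f)) \<longlonglongrightarrow> turan_const M \<Omega>"
      by (simp add: eq)
  qed (use f(1) eq in \<open>simp_all add: uniform_limit_const\<close>)
qed

end
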